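(* If $X$ is a universal pointwise BPB domain space, then $X$ is uniformly convex. Moreover, we have that $$\delta_X(\varepsilon)\geq C\,\varepsilon^q\qquad(0<\varepsilon<2)$$ for suitable $2\leq q<\infty$ and $C>0$.
   Context: Banach spaces are over $\mathbb{K}$, where $\mathbb{K}=\mathbb{R}$ or $\mathbb{K}=\mathbb{C}$. $\mathcal{L}(X,Y)$ is the Banach space of bounded linear operators from $X$ to $Y$; $B_X$, $S_X$ are the closed unit ball and unit sphere of $X$. A pair $(X,Y)$ of Banach spaces has the pointwise BPB property if for every $\varepsilon>0$ there is $\eta>0$ such that whenever $T\in\mathcal{L}(X,Y)$ with $\|T\|=1$ and $x_0\in S_X$ satisfy $\|T(x_0)\|>1-\eta$, there is $S\in\mathcal{L}(X,Y)$ with $\|S\|=1$, $\|S(x_0)\|=1$ and $\|S-T\|<\varepsilon$. A Banach space $X$ is a universal pointwise BPB domain space if $(X,Y)$ has the pointwise BPB property for every Banach space $Y$. The modulus of convexity is $\delta_X(\varepsilon)=\inf\left\{1-\left\|\frac{x+y}{2}\right\|: x,y\in B_X,\ \|x-y\|\geq\varepsilon\right\}$ for $0<\varepsilon\leq2$; $X$ is uniformly convex if $\delta_X(\varepsilon)>0$ for all $\varepsilon\in(0,2]$. *)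

theory Defs
  imports "HOL-Analysis.Analysis" "HOL-Algebra.Module"
begin

text \<open>
  The scalar field is a subset \<open>K\<close> of the complex numbers, either \<open>\<real>\<close> or \<open>UNIV\<close>, so that real and
  complex spaces are treated at once.  In a real space the value of \<open>a \<odot> x\<close> for non-real \<open>a\<close> is
  immaterial.
\<close>

definition scalar_ring :: "complex set \<Rightarrow> complex ring" where
  "scalar_ring K = \<lparr>carrier = K, mult = (*), one = 1, zero = 0, add = (+)\<rparr>"

text \<open>The fields \<open>mult\<close> and \<open>one\<close> inherited from rings play no role in a vector space.\<close>

record 'a nspace = "(complex, 'a) module" +
  vnorm :: "'a \<Rightarrow> real"

locale normed_vs = module "scalar_ring K" X for K and X :: "'a nspace" (structure) +
  assumes vnorm_nonneg: "x \<in> carrier X \<Longrightarrow> 0 \<le> vnorm X x"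
    and vnorm_eq_0: "x \<in> carrier X \<Longrightarrow> vnorm X x = 0 \<longleftrightarrow> x = \<zero>"
    and vnorm_smult: "a \<in> K \<Longrightarrow> x \<in> carrier X \<Longrightarrow> vnorm X (a \<odot> x) = cmod a * vnorm X x"
    and vnorm_triangle:
      "x \<in> carrier X \<Longrightarrow> y \<in> carrier X \<Longrightarrow> vnorm X (x \<oplus> y) \<le> vnorm X x + vnorm X y"

locale banach_space = normed_vs +
  assumes complete:
    "(\<forall>n::nat. s n \<in> carrier X) \<Longrightarrow>
     (\<forall>e>0. \<exists>N. \<forall>m\<ge>N. \<forall>n\<ge>N. vnorm X (s m \<ominus> s n) < e) \<Longrightarrow>
     \<exists>l\<in>carrier X. (\<lambda>n. vnorm X (s n \<ominus> l)) \<longlonglongrightarrow> 0"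

definition unit_ball :: "'a nspace \<Rightarrow> 'a set" where
  "unit_ball X = {x \<in> carrier X. vnorm X x \<le> 1}"

definition unit_sphere :: "'a nspace \<Rightarrow> 'a set" where
  "unit_sphere X = {x \<in> carrier X. vnorm X x = 1}"

text \<open>Operators are considered only on the carrier of \<open>X\<close>; their values outside it are irrelevant.\<close>

definition bounded_ops :: "complex set \<Rightarrow> 'a nspace \<Rightarrow> 'b nspace \<Rightarrow> ('a \<Rightarrow> 'b) set" where
  "bounded_ops K X Y = {T \<in> carrier X \<rightarrow> carrier Y.
     (\<forall>x\<in>carrier X. \<forall>y\<in>carrier X. T (x \<oplus>\<^bsub>X\<^esub> y) = T x \<oplus>\<^bsub>Y\<^esub> T y) \<and>
     (\<forall>a\<in>K. \<forall>x\<in>carrier X. T (a \<odot>\<^bsub>X\<^esub> x) = a \<odot>\<^bsub>Y\<^esub> T x) \<and>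
     (\<exists>B. \<forall>x\<in>carrier X. vnorm Y (T x) \<le> B * vnorm X x)}"

definition op_norm :: "'a nspace \<Rightarrow> 'b nspace \<Rightarrow> ('a \<Rightarrow> 'b) \<Rightarrow> real" where
  "op_norm X Y T = (SUP x\<in>unit_ball X. vnorm Y (T x))"

definition pointwise_BPB :: "complex set \<Rightarrow> 'a nspace \<Rightarrow> 'b nspace \<Rightarrow> bool" where
  "pointwise_BPB K X Y \<longleftrightarrow>
     (\<forall>\<epsilon>>0. \<exists>\<eta>>0. \<forall>T\<in>bounded_ops K X Y. \<forall>x0\<in>unit_sphere X.
        op_norm X Y T = 1 \<and> vnorm Y (T x0) > 1 - \<eta> \<longrightarrow>
        (\<exists>S\<in>bounded_ops K X Y. op_norm X Y S = 1 \<and> vnorm Y (S x0) = 1 \<and>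
           op_norm X Y (\<lambda>x. S x \<ominus>\<^bsub>Y\<^esub> T x) < \<epsilon>))"

text \<open>
  HOL cannot quantify over all types inside a definition, so \<open>Y\<close> ranges over the Banach spaces whose
  carrier is a subset of the type \<open>'a list \<Rightarrow> real\<close>.  This is no restriction: lemma
  \<open>universal_pointwise_BPB_domainD\<close> below derives the property of \<open>(X, Y)\<close> for a Banach space \<open>Y\<close> over
  an arbitrary type.
\<close>

definition universal_pointwise_BPB_domain :: "complex set \<Rightarrow> 'a nspace \<Rightarrow> bool" where
  "universal_pointwise_BPB_domain K X \<longleftrightarrow>
     (\<forall>Y :: ('a list \<Rightarrow> real) nspace. banach_space K Y \<longrightarrow> pointwise_BPB K X Y)"

text \<open>
  The infimum is taken in the extended reals: for \<open>X = {0}\<close> it is the infimum of the empty set,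
  which is \<open>\<infinity>\<close>.
\<close>

definition modulus_convexity :: "'a nspace \<Rightarrow> real \<Rightarrow> ereal" where
  "modulus_convexity X \<epsilon> =
     Inf {ereal (1 - vnorm X ((1/2) \<odot>\<^bsub>X\<^esub> (x \<oplus>\<^bsub>X\<^esub> y))) | x y.
       x \<in> unit_ball X \<and> y \<in> unit_ball X \<and> vnorm X (x \<ominus>\<^bsub>X\<^esub> y) \<ge> \<epsilon>}"

definition uniformly_convex :: "'a nspace \<Rightarrow> bool" where
  "uniformly_convex X \<longleftrightarrow> (\<forall>\<epsilon>\<in>{0<..2}. modulus_convexity X \<epsilon> > 0)"

text \<open>
  The rest of this theory proves \<open>universal_pointwise_BPB_domainD\<close>.  Given operators
  \<open>T 0, T 1, \<dots>\<close> that violate the property of \<open>(X, Y)\<close> for a fixed \<open>\<epsilon>\<close> and \<open>\<eta> \<rightarrow> 0\<close>, the closed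
  span \<open>W\<close> of their ranges is again a Banach space violating it.  The distances of a point of
  \<open>W\<close> to the finite sums \<open>T 0 x\<^sub>0 + \<dots> + T k x\<^sub>k\<close> determine the point, so \<open>W\<close> injects into
  \<open>'a list \<Rightarrow> real\<close>.
\<close>

context normed_vs
begin

lemma carrier_scalars: "carrier (scalar_ring K) = K"
  by (simp add: scalar_ring_def)

lemma minus_one_in: "-1 \<in> K"
proof -
  have "1 \<in> K" using R.one_closed by (simp add: scalar_ring_def)
  then obtain y where y: "y \<in> K" "y + 1 = 0"
    using R.l_neg[of 1] R.a_inv_closed[of 1] by (auto simp: scalar_ring_def)
  then have "y = -1" by (simp add: eq_neg_iff_add_eq_0)
  with y show ?thesis by simp
qed

lemma vs_smult_closed: "a \<in> K \<Longrightarrow> x \<in> carrier X \<Longrightarrow> a \<odot> x \<in> carrier X"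
  using smult_closed by (simp add: carrier_scalars)

lemma vs_smult_r_distr:
  "a \<in> K \<Longrightarrow> x \<in> carrier X \<Longrightarrow> y \<in> carrier X \<Longrightarrow> a \<odot> (x \<oplus> y) = a \<odot> x \<oplus> a \<odot> y"
  using smult_r_distr by (simp add: carrier_scalars)

lemma uminus_smult: "x \<in> carrier X \<Longrightarrow> \<ominus> x = (-1) \<odot> x"
proof -
  assume x: "x \<in> carrier X"
  have "1 \<in> K" using R.one_closed by (simp add: scalar_ring_def)
  then have "((-1) \<odot> x) \<oplus> x = (-1 + 1) \<odot> x"
    using smult_l_distr[of "-1" 1 x] smult_one[OF x] x minus_one_in by (simp add: scalar_ring_def)
  also have "\<dots> = \<zero>" using smult_l_null[OF x] by (simp add: scalar_ring_def)
  finally show ?thesis by (rule minus_equality) (simp_all add: x vs_smult_closed minus_one_in)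
qed

lemma vnorm_zero: "vnorm X \<zero> = 0"
  using vnorm_eq_0[of \<zero>] by simp

lemma vnorm_uminus: "x \<in> carrier X \<Longrightarrow> vnorm X (\<ominus> x) = vnorm X x"
  by (simp add: uminus_smult vnorm_smult minus_one_in)

lemma vnorm_triangle_diff:
  assumes "x \<in> carrier X" "y \<in> carrier X" "z \<in> carrier X"
  shows "vnorm X (x \<ominus> z) \<le> vnorm X (x \<ominus> y) + vnorm X (y \<ominus> z)"
proof -
  have "x \<ominus> z = (x \<ominus> y) \<oplus> (y \<ominus> z)"
    using assms by (simp add: a_minus_def a_assoc r_neg1)
  then show ?thesis using vnorm_triangle[of "x \<ominus> y" "y \<ominus> z"] assms by simp
qed

lemma vnorm_diff_commute:
  assumes "x \<in> carrier X" "y \<in> carrier X"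
  shows "vnorm X (x \<ominus> y) = vnorm X (y \<ominus> x)"
proof -
  have "\<ominus> (y \<ominus> x) = x \<ominus> y"
    using assms by (simp add: a_minus_def minus_add a_comm)
  then show ?thesis using vnorm_uminus[of "y \<ominus> x"] assms by simp
qed

end

text \<open>A subspace \<open>W\<close> of \<open>Y\<close>, transported along an injection.\<close>

definition transport :: "('b \<Rightarrow> 'c) \<Rightarrow> 'b set \<Rightarrow> 'b nspace \<Rightarrow> 'c nspace" where
  "transport f W Y =
    \<lparr>carrier = f ` W, mult = (\<lambda>_. id), one = f \<zero>\<^bsub>Y\<^esub>, zero = f \<zero>\<^bsub>Y\<^esub>,
     add = (\<lambda>u v. f (inv_into W f u \<oplus>\<^bsub>Y\<^esub> inv_into W f v)),
     smult = (\<lambda>a u. f (a \<odot>\<^bsub>Y\<^esub> inv_into W f u)),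
     vnorm = (\<lambda>u. vnorm Y (inv_into W f u))\<rparr>"

locale closed_subspace = banach_space K Y for K and Y :: "'b nspace" (structure) +
  fixes W :: "'b set" and f :: "'b \<Rightarrow> 'c"
  assumes W_sub: "W \<subseteq> carrier Y" and W0: "\<zero> \<in> W"
    and W_add: "u \<in> W \<Longrightarrow> v \<in> W \<Longrightarrow> u \<oplus> v \<in> W"
    and W_smult: "a \<in> K \<Longrightarrow> u \<in> W \<Longrightarrow> a \<odot> u \<in> W"
    and W_closed: "(\<forall>n::nat. s n \<in> W) \<Longrightarrow> l \<in> carrier Y \<Longrightarrow>
      (\<lambda>n. vnorm Y (s n \<ominus> l)) \<longlonglongrightarrow> 0 \<Longrightarrow> l \<in> W"
    and inj: "inj_on f W"
begin

abbreviation "Z \<equiv> transport f W Y"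
abbreviation "g \<equiv> inv_into W f"

lemma g_f [simp]: "u \<in> W \<Longrightarrow> g (f u) = u"
  using inj by simp

lemma W_carrier: "u \<in> W \<Longrightarrow> u \<in> carrier Y"
  using W_sub by blast

lemma Z_simps [simp]:
  "carrier Z = f ` W" "\<zero>\<^bsub>Z\<^esub> = f \<zero>" "vnorm Z u = vnorm Y (g u)"
  by (simp_all add: transport_def)

lemma Z_add [simp]: "u \<in> W \<Longrightarrow> v \<in> W \<Longrightarrow> f u \<oplus>\<^bsub>Z\<^esub> f v = f (u \<oplus> v)"
  by (simp add: transport_def)

lemma Z_smult [simp]: "u \<in> W \<Longrightarrow> a \<odot>\<^bsub>Z\<^esub> f u = f (a \<odot> u)"
  by (simp add: transport_def)

lemma W_uminus: "u \<in> W \<Longrightarrow> \<ominus> u \<in> W"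
  by (simp add: uminus_smult W_carrier W_smult minus_one_in)

lemma abelian_Z: "abelian_group Z"
proof (rule abelian_groupI)
  fix x assume "x \<in> carrier Z"
  then obtain u where u: "u \<in> W" "x = f u" by auto
  show "\<exists>y\<in>carrier Z. y \<oplus>\<^bsub>Z\<^esub> x = \<zero>\<^bsub>Z\<^esub>"
    by (rule bexI[of _ "f (\<ominus> u)"]) (use u W_uminus W_carrier in \<open>auto simp: l_neg\<close>)
qed (auto simp: W0 W_add W_carrier a_ac)

lemma module_Z: "module (scalar_ring K) Z"
proof (rule moduleI)
  show "cring (scalar_ring K)" by (rule R.is_cring)
  show "abelian_group Z" by (rule abelian_Z)
  fix a x assume "a \<in> carrier (scalar_ring K)" and "x \<in> carrier Z"
  then show "a \<odot>\<^bsub>Z\<^esub> x \<in> carrier Z" by (auto simp: W_smult carrier_scalars)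
next
  fix a b x
  assume ab: "a \<in> carrier (scalar_ring K)" "b \<in> carrier (scalar_ring K)" and "x \<in> carrier Z"
  then obtain u where u: "u \<in> W" "x = f u" by auto
  show "(a \<oplus>\<^bsub>scalar_ring K\<^esub> b) \<odot>\<^bsub>Z\<^esub> x = a \<odot>\<^bsub>Z\<^esub> x \<oplus>\<^bsub>Z\<^esub> b \<odot>\<^bsub>Z\<^esub> x"
    using u ab by (simp add: W_smult carrier_scalars smult_l_distr W_carrier)
  show "(a \<otimes>\<^bsub>scalar_ring K\<^esub> b) \<odot>\<^bsub>Z\<^esub> x = a \<odot>\<^bsub>Z\<^esub> (b \<odot>\<^bsub>Z\<^esub> x)"
    using u ab by (simp add: W_smult carrier_scalars smult_assoc1 W_carrier)
next
  fix a x y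
  assume "a \<in> carrier (scalar_ring K)" "x \<in> carrier Z" "y \<in> carrier Z"
  then show "a \<odot>\<^bsub>Z\<^esub> (x \<oplus>\<^bsub>Z\<^esub> y) = a \<odot>\<^bsub>Z\<^esub> x \<oplus>\<^bsub>Z\<^esub> a \<odot>\<^bsub>Z\<^esub> y"
    by (auto simp: W_smult W_add carrier_scalars smult_r_distr W_carrier)
next
  fix x assume "x \<in> carrier Z"
  then show "\<one>\<^bsub>scalar_ring K\<^esub> \<odot>\<^bsub>Z\<^esub> x = x"
    by (auto simp: W_carrier)
qed

lemma g_diff: "u \<in> W \<Longrightarrow> v \<in> W \<Longrightarrow> f u \<ominus>\<^bsub>Z\<^esub> f v = f (u \<ominus> v)"
proof -
  assume u: "u \<in> W" and v: "v \<in> W"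
  interpret Z: abelian_group Z by (rule abelian_Z)
  have "\<ominus>\<^bsub>Z\<^esub> f v = f (\<ominus> v)"
    using v W_uminus W_carrier by (intro Z.minus_equality) (auto simp: l_neg)
  then show ?thesis using u v by (simp add: a_minus_def W_uminus)
qed

lemma W_diff: "u \<in> W \<Longrightarrow> v \<in> W \<Longrightarrow> u \<ominus> v \<in> W"
  by (simp add: a_minus_def W_add W_uminus)

lemma banach_Z: "banach_space K Z"
proof -
  have nv: "normed_vs_axioms K Z"
  proof
    fix x assume "x \<in> carrier Z"
    then obtain u where u: "u \<in> W" "x = f u" by auto
    show "0 \<le> vnorm Z x" using u by (simp add: vnorm_nonneg W_carrier)
    have "f u = f \<zero> \<longleftrightarrow> u = \<zero>" using u W0 inj by (auto dest: inj_onD)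
    then show "(vnorm Z x = 0) = (x = \<zero>\<^bsub>Z\<^esub>)"
      using u vnorm_eq_0 W_carrier by simp
  next
    fix a x assume "a \<in> K" "x \<in> carrier Z"
    then show "vnorm Z (a \<odot>\<^bsub>Z\<^esub> x) = cmod a * vnorm Z x"
      by (auto simp: W_smult vnorm_smult W_carrier)
  next
    fix x y assume "x \<in> carrier Z" "y \<in> carrier Z"
    then show "vnorm Z (x \<oplus>\<^bsub>Z\<^esub> y) \<le> vnorm Z x + vnorm Z y"
      by (auto simp: W_add vnorm_triangle W_carrier)
  qed
  have "banach_space_axioms Z"
  proof
    fix s :: "nat \<Rightarrow> 'c"
    assume "\<forall>n. s n \<in> carrier Z"
    then have gs: "g (s n) \<in> W" "f (g (s n)) = s n" for n
      by (auto simp: inv_into_into f_inv_into_f)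
    assume C: "\<forall>e>0. \<exists>N. \<forall>m\<ge>N. \<forall>n\<ge>N. vnorm Z (s m \<ominus>\<^bsub>Z\<^esub> s n) < e"
    have eq: "vnorm Z (s m \<ominus>\<^bsub>Z\<^esub> f u) = vnorm Y (g (s m) \<ominus> u)" if "u \<in> W" for m u
      using g_diff[OF gs(1)[of m] that] gs(2)[of m] W_diff[OF gs(1)[of m] that] by simp
    have eq2: "vnorm Z (s m \<ominus>\<^bsub>Z\<^esub> s n) = vnorm Y (g (s m) \<ominus> g (s n))" for m n
      using eq[OF gs(1)[of n], of m] gs(2)[of n] by simp
    obtain l where l: "l \<in> carrier Y" "(\<lambda>n. vnorm Y (g (s n) \<ominus> l)) \<longlonglongrightarrow> 0"
      using complete[of "\<lambda>n. g (s n)"] C[unfolded eq2] gs(1) W_carrier by blast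
    then have lW: "l \<in> W" using W_closed[of "\<lambda>n. g (s n)" l] gs(1) by blast
    show "\<exists>l\<in>carrier Z. (\<lambda>n. vnorm Z (s n \<ominus>\<^bsub>Z\<^esub> l)) \<longlonglongrightarrow> 0"
      by (rule bexI[of _ "f l"]) (use lW l(2) eq[OF lW] in simp_all)
  qed
  with nv module_Z show ?thesis
    by (simp add: banach_space_def normed_vs_def)
qed

lemma transport_fails:
  fixes X :: "'a nspace"
  assumes Zbpb: "pointwise_BPB K X Z" and "\<epsilon> > 0"
  shows "\<exists>\<eta>>0. \<forall>T\<in>bounded_ops K X Y. \<forall>x0\<in>unit_sphere X. T ` carrier X \<subseteq> W \<longrightarrow>
        op_norm X Y T = 1 \<and> vnorm Y (T x0) > 1 - \<eta> \<longrightarrow>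
        (\<exists>S\<in>bounded_ops K X Y. op_norm X Y S = 1 \<and> vnorm Y (S x0) = 1 \<and>
           op_norm X Y (\<lambda>x. S x \<ominus> T x) < \<epsilon>)"
proof -
  obtain \<eta> where \<eta>: "\<eta> > 0" "\<And>T x0. T\<in>bounded_ops K X Z \<Longrightarrow> x0\<in>unit_sphere X \<Longrightarrow>
        op_norm X Z T = 1 \<Longrightarrow> vnorm Z (T x0) > 1 - \<eta> \<Longrightarrow>
        (\<exists>S\<in>bounded_ops K X Z. op_norm X Z S = 1 \<and> vnorm Z (S x0) = 1 \<and>
           op_norm X Z (\<lambda>x. S x \<ominus>\<^bsub>Z\<^esub> T x) < \<epsilon>)"
    using Zbpb \<open>\<epsilon> > 0\<close> unfolding pointwise_BPB_def by meson
  have ball: "x \<in> carrier X" if "x \<in> unit_ball X" for x using that by (simp add: unit_ball_def)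
  show ?thesis
  proof (intro exI[of _ \<eta>] conjI ballI impI, rule \<eta>)
    fix T x0
    assume T: "T \<in> bounded_ops K X Y" and x0: "x0 \<in> unit_sphere X" and TW: "T ` carrier X \<subseteq> W"
      and T1: "op_norm X Y T = 1 \<and> 1 - \<eta> < vnorm Y (T x0)"
    have TW': "T x \<in> W" if "x \<in> carrier X" for x using TW that by blast
    have x0c: "x0 \<in> carrier X" using x0 by (simp add: unit_sphere_def)
    define T' where "T' = (\<lambda>x. f (T x))"
    have "T' \<in> bounded_ops K X Z"
      using T TW' by (auto simp: bounded_ops_def T'_def)
    moreover have "op_norm X Z T' = op_norm X Y T"
      unfolding op_norm_def by (intro SUP_cong) (auto simp: T'_def TW' dest: ball)
    moreover have "vnorm Z (T' x0) = vnorm Y (T x0)" by (simp add: T'_def TW' x0c)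
    ultimately obtain S where S: "S\<in>bounded_ops K X Z" "op_norm X Z S = 1" "vnorm Z (S x0) = 1"
      "op_norm X Z (\<lambda>x. S x \<ominus>\<^bsub>Z\<^esub> T' x) < \<epsilon>"
      using \<eta>(2)[of T' x0] x0 T1 by auto
    define S' where "S' = (\<lambda>x. g (S x))"
    have Sx: "S' x \<in> W" "S x = f (S' x)" if "x \<in> carrier X" for x
    proof -
      have "S x \<in> f ` W" using S(1) that by (auto simp: bounded_ops_def)
      then show "S' x \<in> W" "S x = f (S' x)" by (simp_all add: S'_def inv_into_into f_inv_into_f)
    qed
    have S'b: "S' \<in> bounded_ops K X Y"
    proof -
      have "S' (x \<oplus>\<^bsub>X\<^esub> y) = S' x \<oplus> S' y" if "x \<in> carrier X" "y \<in> carrier X" for x y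
      proof -
        have "S (x \<oplus>\<^bsub>X\<^esub> y) = S x \<oplus>\<^bsub>Z\<^esub> S y" using S(1) that by (auto simp: bounded_ops_def)
        also have "\<dots> = f (S' x \<oplus> S' y)"
          by (simp only: Sx(2)[OF that(1)] Sx(2)[OF that(2)] Z_add[OF Sx(1)[OF that(1)] Sx(1)[OF that(2)]])
        finally have "S' (x \<oplus>\<^bsub>X\<^esub> y) = g (f (S' x \<oplus> S' y))" by (simp only: S'_def)
        then show ?thesis using W_add[OF Sx(1)[OF that(1)] Sx(1)[OF that(2)]] by simp
      qed
      moreover have "S' (a \<odot>\<^bsub>X\<^esub> x) = a \<odot> S' x" if "a \<in> K" "x \<in> carrier X" for a x
      proof -
        have "S (a \<odot>\<^bsub>X\<^esub> x) = a \<odot>\<^bsub>Z\<^esub> S x" using S(1) that by (auto simp: bounded_ops_def)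
        also have "\<dots> = f (a \<odot> S' x)"
          by (simp only: Sx(2)[OF that(2)] Z_smult[OF Sx(1)[OF that(2)]])
        finally have "S' (a \<odot>\<^bsub>X\<^esub> x) = g (f (a \<odot> S' x))" by (simp only: S'_def)
        then show ?thesis using W_smult[OF that(1) Sx(1)[OF that(2)]] by simp
      qed
      moreover have "\<exists>B. \<forall>x\<in>carrier X. vnorm Y (S' x) \<le> B * vnorm X x"
        using S(1) by (auto simp: bounded_ops_def S'_def)
      ultimately show ?thesis using Sx(1) W_carrier by (auto simp: bounded_ops_def)
    qed
    have "vnorm Z (S x \<ominus>\<^bsub>Z\<^esub> T' x) = vnorm Y (S' x \<ominus> T x)" if "x \<in> carrier X" for x
      unfolding T'_def Sx(2)[OF that] g_diff[OF Sx(1)[OF that] TW'[OF that]]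
      using W_diff[OF Sx(1)[OF that] TW'[OF that]] by simp
    then have diff: "op_norm X Z (\<lambda>x. S x \<ominus>\<^bsub>Z\<^esub> T' x) = op_norm X Y (\<lambda>x. S' x \<ominus> T x)"
      unfolding op_norm_def by (intro SUP_cong refl) (use ball in blast)
    show "\<exists>S\<in>bounded_ops K X Y. op_norm X Y S = 1 \<and> vnorm Y (S x0) = 1 \<and>
           op_norm X Y (\<lambda>x. S x \<ominus> T x) < \<epsilon>"
    proof (intro bexI[of _ S'] conjI)
      show "op_norm X Y S' = 1" using S(2) by (simp add: op_norm_def S'_def)
      show "vnorm Y (S' x0) = 1" using S(3) by (simp add: S'_def)
      show "op_norm X Y (\<lambda>x. S' x \<ominus> T x) < \<epsilon>" using S(4) diff by simp
    qed (rule S'b)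
  qed
qed

end

text \<open>Finite sums of values of \<open>T 0, T 1, \<dots>\<close>, indexed by lists of arguments.\<close>

fun lsum :: "'b nspace \<Rightarrow> (nat \<Rightarrow> 'a \<Rightarrow> 'b) \<Rightarrow> nat \<Rightarrow> 'a list \<Rightarrow> 'b" where
  "lsum Y T n [] = \<zero>\<^bsub>Y\<^esub>"
| "lsum Y T n (x # xs) = T n x \<oplus>\<^bsub>Y\<^esub> lsum Y T (Suc n) xs"

locale op_sequence = X: banach_space K X + Y: banach_space K Y
  for K and X :: "'a nspace" and Y :: "'b nspace" +
  fixes T :: "nat \<Rightarrow> 'a \<Rightarrow> 'b"
  assumes T: "T n \<in> bounded_ops K X Y"
begin

definition "D = lsum Y T 0 ` lists (carrier X)"
definition "W = {y \<in> carrier Y. \<forall>e>0. \<exists>d\<in>D. vnorm Y (y \<ominus>\<^bsub>Y\<^esub> d) < e}"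
definition "f y = (\<lambda>xs. if xs \<in> lists (carrier X) then vnorm Y (y \<ominus>\<^bsub>Y\<^esub> lsum Y T 0 xs) else 0)"

lemma Tc: "x \<in> carrier X \<Longrightarrow> T n x \<in> carrier Y"
  using T[of n] by (auto simp: bounded_ops_def)

lemma T_add: "x \<in> carrier X \<Longrightarrow> y \<in> carrier X \<Longrightarrow> T n (x \<oplus>\<^bsub>X\<^esub> y) = T n x \<oplus>\<^bsub>Y\<^esub> T n y"
  using T by (auto simp: bounded_ops_def)

lemma T_smult: "a \<in> K \<Longrightarrow> x \<in> carrier X \<Longrightarrow> T n (a \<odot>\<^bsub>X\<^esub> x) = a \<odot>\<^bsub>Y\<^esub> T n x"
  using T by (auto simp: bounded_ops_def)

lemma T_zero: "T n \<zero>\<^bsub>X\<^esub> = \<zero>\<^bsub>Y\<^esub>"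
proof -
  have "T n \<zero>\<^bsub>X\<^esub> \<oplus>\<^bsub>Y\<^esub> T n \<zero>\<^bsub>X\<^esub> = T n \<zero>\<^bsub>X\<^esub>"
    using T_add[of "\<zero>\<^bsub>X\<^esub>" "\<zero>\<^bsub>X\<^esub>" n] by simp
  then show ?thesis using Tc[of "\<zero>\<^bsub>X\<^esub>" n] by simp
qed

lemma lsum_closed: "xs \<in> lists (carrier X) \<Longrightarrow> lsum Y T n xs \<in> carrier Y"
  by (induction xs arbitrary: n) (auto simp: Tc)

lemma lsum_add:
  "xs \<in> lists (carrier X) \<Longrightarrow> ys \<in> lists (carrier X) \<Longrightarrow>
   \<exists>zs\<in>lists (carrier X). lsum Y T n zs = lsum Y T n xs \<oplus>\<^bsub>Y\<^esub> lsum Y T n ys"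
proof (induction xs arbitrary: ys n)
  case Nil
  then show ?case by (auto simp: lsum_closed intro!: bexI[of _ ys])
next
  case (Cons x xs)
  show ?case
  proof (cases ys)
    case Nil
    then show ?thesis using Cons.prems lsum_closed[OF Cons.prems(1), of n] by (intro bexI[of _ "x # xs"]) auto
  next
    case (Cons y ys')
    then have in': "x \<in> carrier X" "xs \<in> lists (carrier X)" "y \<in> carrier X" "ys' \<in> lists (carrier X)"
      using Cons.prems by auto
    obtain zs where zs: "zs \<in> lists (carrier X)"
      "lsum Y T (Suc n) zs = lsum Y T (Suc n) xs \<oplus>\<^bsub>Y\<^esub> lsum Y T (Suc n) ys'"
      using Cons.IH[OF in'(2,4)] by blast
    show ?thesis
      by (rule bexI[of _ "(x \<oplus>\<^bsub>X\<^esub> y) # zs"])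
        (use in' zs Cons in \<open>auto simp: T_add Tc lsum_closed Y.a_ac\<close>)
  qed
qed

lemma lsum_smult:
  "a \<in> K \<Longrightarrow> xs \<in> lists (carrier X) \<Longrightarrow>
   lsum Y T n (map (\<lambda>x. a \<odot>\<^bsub>X\<^esub> x) xs) = a \<odot>\<^bsub>Y\<^esub> lsum Y T n xs"
proof (induction xs arbitrary: n)
  case Nil
  then show ?case using Y.smult_r_null[of a] by (simp add: Y.carrier_scalars)
qed (auto simp: T_smult Y.vs_smult_r_distr Tc lsum_closed)

lemma D_sub: "D \<subseteq> carrier Y"
  using lsum_closed by (auto simp: D_def simp del: in_lists_conv_set)

lemma D_add: "d \<in> D \<Longrightarrow> d' \<in> D \<Longrightarrow> d \<oplus>\<^bsub>Y\<^esub> d' \<in> D"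
proof -
  assume "d \<in> D" "d' \<in> D"
  then obtain xs ys where x: "xs \<in> lists (carrier X)" "d = lsum Y T 0 xs"
    "ys \<in> lists (carrier X)" "d' = lsum Y T 0 ys" by (auto simp: D_def)
  obtain zs where "zs \<in> lists (carrier X)" "lsum Y T 0 zs = d \<oplus>\<^bsub>Y\<^esub> d'"
    using lsum_add[OF x(1,3), of 0] x(2,4) by blast
  then show ?thesis unfolding D_def by (intro image_eqI[of _ _ zs]) simp_all
qed

lemma D_smult: "a \<in> K \<Longrightarrow> d \<in> D \<Longrightarrow> a \<odot>\<^bsub>Y\<^esub> d \<in> D"
proof -
  assume a: "a \<in> K" and "d \<in> D"
  then obtain xs where xs: "xs \<in> lists (carrier X)" "d = lsum Y T 0 xs" by (auto simp: D_def)
  have "map (\<lambda>x. a \<odot>\<^bsub>X\<^esub> x) xs \<in> lists (carrier X)"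
    using xs(1) a by (auto simp: X.vs_smult_closed in_lists_conv_set)
  then show ?thesis using lsum_smult[OF a xs(1), of 0] xs(2) unfolding D_def by (intro image_eqI) simp_all
qed

lemma D_W: "d \<in> D \<Longrightarrow> d \<in> W"
  using D_sub by (auto simp: W_def Y.vnorm_zero a_minus_def Y.r_neg intro!: bexI[of _ d])

lemma T_D: assumes x: "x \<in> carrier X" shows "T n x \<in> D"
proof -
  have "lsum Y T m (replicate k \<zero>\<^bsub>X\<^esub> @ [x]) = T (m + k) x" for m k
    by (induction k arbitrary: m) (auto simp: T_zero Tc x)
  then have "T n x = lsum Y T 0 (replicate n \<zero>\<^bsub>X\<^esub> @ [x])" by simp
  moreover have "replicate n \<zero>\<^bsub>X\<^esub> @ [x] \<in> lists (carrier X)"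
    using x by (auto simp: in_lists_conv_set)
  ultimately show ?thesis unfolding D_def by blast
qed

lemma W_approx:
  assumes "u \<in> W" "e > 0" obtains d where "d \<in> D" "vnorm Y (u \<ominus>\<^bsub>Y\<^esub> d) < e"
  using assms by (auto simp: W_def)

lemma closed_subspace: "closed_subspace K Y W f"
proof unfold_locales
  show "W \<subseteq> carrier Y" by (auto simp: W_def)
  have "\<zero>\<^bsub>Y\<^esub> \<in> D" unfolding D_def by (rule image_eqI[of _ _ "[]"]) auto
  then show "\<zero>\<^bsub>Y\<^esub> \<in> W" by (rule D_W)
next
  fix u v assume u: "u \<in> W" and v: "v \<in> W"
  show "u \<oplus>\<^bsub>Y\<^esub> v \<in> W"
    unfolding W_def
  proof (intro CollectI conjI allI impI)
    show "u \<oplus>\<^bsub>Y\<^esub> v \<in> carrier Y" using u v by (simp add: W_def)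
    fix e :: real assume "e > 0"
    then have e2: "e/2 > 0" by simp
    obtain d where d: "d \<in> D" "vnorm Y (u \<ominus>\<^bsub>Y\<^esub> d) < e/2"
      by (rule W_approx[OF u e2])
    obtain d' where d': "d' \<in> D" "vnorm Y (v \<ominus>\<^bsub>Y\<^esub> d') < e/2"
      by (rule W_approx[OF v e2])
    have c: "u \<in> carrier Y" "v \<in> carrier Y" "d \<in> carrier Y" "d' \<in> carrier Y"
      using u v d d' D_sub by (auto simp: W_def)
    have "(u \<oplus>\<^bsub>Y\<^esub> v) \<ominus>\<^bsub>Y\<^esub> (d \<oplus>\<^bsub>Y\<^esub> d') = (u \<ominus>\<^bsub>Y\<^esub> d) \<oplus>\<^bsub>Y\<^esub> (v \<ominus>\<^bsub>Y\<^esub> d')"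
      using c by (simp add: a_minus_def Y.minus_add Y.a_ac)
    then have "vnorm Y ((u \<oplus>\<^bsub>Y\<^esub> v) \<ominus>\<^bsub>Y\<^esub> (d \<oplus>\<^bsub>Y\<^esub> d')) < e"
      using Y.vnorm_triangle[of "u \<ominus>\<^bsub>Y\<^esub> d" "v \<ominus>\<^bsub>Y\<^esub> d'"] c d d' by simp
    then show "\<exists>d\<in>D. vnorm Y ((u \<oplus>\<^bsub>Y\<^esub> v) \<ominus>\<^bsub>Y\<^esub> d) < e" using D_add d d' by blast
  qed
next
  fix a u assume a: "a \<in> K" and u: "u \<in> W"
  show "a \<odot>\<^bsub>Y\<^esub> u \<in> W"
    unfolding W_def
  proof (intro CollectI conjI allI impI)
    show "a \<odot>\<^bsub>Y\<^esub> u \<in> carrier Y" using u a by (simp add: W_def Y.vs_smult_closed)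
    fix e :: real assume "e > 0"
    then have e': "e / (cmod a + 1) > 0" by (simp add: add_nonneg_pos)
    obtain d where d: "d \<in> D" "vnorm Y (u \<ominus>\<^bsub>Y\<^esub> d) < e / (cmod a + 1)"
      by (rule W_approx[OF u e'])
    have c: "u \<in> carrier Y" "d \<in> carrier Y"
      using u d D_sub by (auto simp: W_def)
    have ma: "\<ominus>\<^bsub>Y\<^esub> (a \<odot>\<^bsub>Y\<^esub> d) = a \<odot>\<^bsub>Y\<^esub> (\<ominus>\<^bsub>Y\<^esub> d)"
      using Y.smult_r_minus[of a d] a c by (simp add: Y.carrier_scalars)
    have eq: "(a \<odot>\<^bsub>Y\<^esub> u) \<ominus>\<^bsub>Y\<^esub> (a \<odot>\<^bsub>Y\<^esub> d) = a \<odot>\<^bsub>Y\<^esub> (u \<ominus>\<^bsub>Y\<^esub> d)"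
      using c a by (simp add: a_minus_def ma Y.vs_smult_r_distr)
    have "cmod a * vnorm Y (u \<ominus>\<^bsub>Y\<^esub> d) \<le> (cmod a + 1) * vnorm Y (u \<ominus>\<^bsub>Y\<^esub> d)"
      using c by (simp add: mult_right_mono Y.vnorm_nonneg)
    also have "\<dots> < e" using d(2) by (simp add: pos_less_divide_eq add_nonneg_pos mult.commute)
    finally have "vnorm Y ((a \<odot>\<^bsub>Y\<^esub> u) \<ominus>\<^bsub>Y\<^esub> (a \<odot>\<^bsub>Y\<^esub> d)) < e"
      using eq Y.vnorm_smult[OF a, of "u \<ominus>\<^bsub>Y\<^esub> d"] c by simp
    then show "\<exists>d\<in>D. vnorm Y ((a \<odot>\<^bsub>Y\<^esub> u) \<ominus>\<^bsub>Y\<^esub> d) < e" using D_smult a d by blast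
  qed
next
  fix s :: "nat \<Rightarrow> 'b" and l
  assume s: "\<forall>n. s n \<in> W" and l: "l \<in> carrier Y" and lim: "(\<lambda>n. vnorm Y (s n \<ominus>\<^bsub>Y\<^esub> l)) \<longlonglongrightarrow> 0"
  show "l \<in> W"
    unfolding W_def
  proof (intro CollectI conjI allI impI l)
    fix e :: real assume "e > 0"
    then have "\<forall>\<^sub>F n in sequentially. vnorm Y (s n \<ominus>\<^bsub>Y\<^esub> l) < e/2"
      using order_tendstoD(2)[OF lim, of "e/2"] by simp
    then obtain n where n: "vnorm Y (s n \<ominus>\<^bsub>Y\<^esub> l) < e/2"
      using eventually_happens'[OF sequentially_bot] by blast
    obtain d where d: "d \<in> D" "vnorm Y (s n \<ominus>\<^bsub>Y\<^esub> d) < e/2"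
      by (rule W_approx[of "s n" "e/2"]) (use s \<open>e > 0\<close> in auto)
    have c: "s n \<in> carrier Y" "d \<in> carrier Y"
      using s d D_sub by (auto simp: W_def)
    have "vnorm Y (l \<ominus>\<^bsub>Y\<^esub> d) < e"
      using Y.vnorm_triangle_diff[OF l c] Y.vnorm_diff_commute[OF l c(1)] n d(2) by simp
    then show "\<exists>d\<in>D. vnorm Y (l \<ominus>\<^bsub>Y\<^esub> d) < e" using d by blast
  qed
next
  show "inj_on f W"
  proof (rule inj_onI)
    fix u v assume u: "u \<in> W" and v: "v \<in> W" and fuv: "f u = f v"
    have c: "u \<in> carrier Y" "v \<in> carrier Y" using u v by (auto simp: W_def)
    have eq: "vnorm Y (u \<ominus>\<^bsub>Y\<^esub> d) = vnorm Y (v \<ominus>\<^bsub>Y\<^esub> d)" if d: "d \<in> D" for d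
    proof -
      obtain xs where xs: "xs \<in> lists (carrier X)" "d = lsum Y T 0 xs" using d by (auto simp: D_def)
      show ?thesis using fun_cong[OF fuv, of xs] xs by (simp add: f_def)
    qed
    have "vnorm Y (u \<ominus>\<^bsub>Y\<^esub> v) \<le> 0 + e" if e: "e > 0" for e
    proof -
      obtain d where d: "d \<in> D" "vnorm Y (u \<ominus>\<^bsub>Y\<^esub> d) < e/2"
        by (rule W_approx[OF u, of "e/2"]) (use e in auto)
      have dc: "d \<in> carrier Y" using d D_sub by auto
      show ?thesis
        using Y.vnorm_triangle_diff[OF c(1) dc c(2)] Y.vnorm_diff_commute[OF dc c(2)] d eq[OF d(1)]
        by simp
    qed
    then have "vnorm Y (u \<ominus>\<^bsub>Y\<^esub> v) \<le> 0" by (rule field_le_epsilon)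
    then have "vnorm Y (u \<ominus>\<^bsub>Y\<^esub> v) = 0"
      using Y.vnorm_nonneg[of "u \<ominus>\<^bsub>Y\<^esub> v"] c by simp
    then have "u \<ominus>\<^bsub>Y\<^esub> v = \<zero>\<^bsub>Y\<^esub>" using Y.vnorm_eq_0[of "u \<ominus>\<^bsub>Y\<^esub> v"] c by simp
    moreover have "u = (u \<ominus>\<^bsub>Y\<^esub> v) \<oplus>\<^bsub>Y\<^esub> v"
      using c by (simp add: a_minus_def Y.a_assoc Y.l_neg)
    ultimately show "u = v" using c by simp
  qed
qed

end

theorem universal_pointwise_BPB_domainD:
  fixes X :: "'a nspace" and Y :: "'b nspace"
  assumes X: "banach_space K X" and U: "universal_pointwise_BPB_domain K X"
    and Y: "banach_space K Y"
  shows "pointwise_BPB K X Y"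
proof (rule ccontr)
  define bad where "bad \<epsilon> \<eta> T x0 \<longleftrightarrow> T \<in> bounded_ops K X Y \<and> x0 \<in> unit_sphere X \<and>
        op_norm X Y T = 1 \<and> vnorm Y (T x0) > 1 - \<eta> \<and>
        \<not> (\<exists>S\<in>bounded_ops K X Y. op_norm X Y S = 1 \<and> vnorm Y (S x0) = 1 \<and>
           op_norm X Y (\<lambda>x. S x \<ominus>\<^bsub>Y\<^esub> T x) < \<epsilon>)" for \<epsilon> \<eta> T x0
  have "(\<forall>T\<in>bounded_ops K X Y. \<forall>x0\<in>unit_sphere X.
        op_norm X Y T = 1 \<and> vnorm Y (T x0) > 1 - \<eta> \<longrightarrow>
        (\<exists>S\<in>bounded_ops K X Y. op_norm X Y S = 1 \<and> vnorm Y (S x0) = 1 \<and>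
           op_norm X Y (\<lambda>x. S x \<ominus>\<^bsub>Y\<^esub> T x) < \<epsilon>)) \<longleftrightarrow> (\<forall>T x0. \<not> bad \<epsilon> \<eta> T x0)" for \<epsilon> \<eta>
    unfolding bad_def by blast
  then have bad_iff: "pointwise_BPB K X Y \<longleftrightarrow> (\<forall>\<epsilon>>0. \<exists>\<eta>>0. \<forall>T x0. \<not> bad \<epsilon> \<eta> T x0)"
    unfolding pointwise_BPB_def by simp
  assume "\<not> pointwise_BPB K X Y"
  then obtain \<epsilon> where \<epsilon>: "\<epsilon> > 0" "\<And>\<eta>. \<eta> > 0 \<Longrightarrow> \<exists>T x0. bad \<epsilon> \<eta> T x0"
    unfolding bad_iff by blast
  have "\<forall>n. \<exists>T x0. bad \<epsilon> (inverse (real (Suc n))) T x0"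
    by (intro allI \<epsilon>(2)) simp
  then obtain T x0 where bad: "\<And>n. bad \<epsilon> (inverse (real (Suc n))) (T n) (x0 n)"
    by metis
  interpret op_sequence K X Y T
    using X Y bad by (auto simp: op_sequence_def op_sequence_axioms_def bad_def)
  interpret W: closed_subspace K Y W f by (rule closed_subspace)
  have "pointwise_BPB K X (transport f W Y)"
    using U W.banach_Z by (simp add: universal_pointwise_BPB_domain_def)
  from W.transport_fails[OF this \<epsilon>(1)] obtain \<eta> where \<eta>: "\<eta> > 0"
    "\<And>T x0. T\<in>bounded_ops K X Y \<Longrightarrow> x0\<in>unit_sphere X \<Longrightarrow> T ` carrier X \<subseteq> W \<Longrightarrow>
        op_norm X Y T = 1 \<Longrightarrow> vnorm Y (T x0) > 1 - \<eta> \<Longrightarrow>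
        (\<exists>S\<in>bounded_ops K X Y. op_norm X Y S = 1 \<and> vnorm Y (S x0) = 1 \<and>
           op_norm X Y (\<lambda>x. S x \<ominus>\<^bsub>Y\<^esub> T x) < \<epsilon>)"
    by meson
  obtain n where n: "inverse (real (Suc n)) < \<eta>" using reals_Archimedean[OF \<eta>(1)] by blast
  have "T n ` carrier X \<subseteq> W" using T_D D_W by blast
  then show False using \<eta>(2)[of "T n" "x0 n"] bad[of n] n by (auto simp: bad_def)
qed

end

theory Submission
  imports Defs
begin

text \<open>
  Give pairs \<open>(a, b)\<close> of scalars the norm
  \<open>max (sqrt ((1 - c) * \<bar>a\<bar>\<^sup>2 + c * \<bar>b\<bar>\<^sup>2)) (\<bar>b\<bar> / 2)\<close>, which near the axis \<open>b = 0\<close> is Euclidean, however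
  small \<open>c > 0\<close> is, and let \<open>Y\<close> be the sup-normed sum of these spaces over a sequence of weights
  \<open>c \<rightarrow> 0\<close>.  Because all weights occur in the same \<open>Y\<close>, some weight \<open>c\<close> lies below the \<open>\<eta>\<close> that the
  property of \<open>(X, Y)\<close> provides for \<open>\<epsilon> = 1/4\<close>.

  Given \<open>x, y\<close> in the unit ball, let \<open>f\<close> and \<open>g\<close> be norming functionals of \<open>x + y\<close> and \<open>x - y\<close>,
  and let \<open>T\<close> be a multiple of \<open>(f, g)\<close>, placed in the coordinate of weight \<open>c\<close>.  At
  \<open>x\<^sub>0 = (x + y) / \<parallel>x + y\<parallel>\<close> it attains its norm up to \<open>c < \<eta>\<close>.  An operator \<open>S\<close> within
  \<open>1/4\<close> of \<open>T\<close> that attains its norm at \<open>x\<^sub>0\<close> must do so in the same coordinate, through the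
  Euclidean part of the norm.  The parallelogram law there bounds \<open>c * \<bar>b (S (x - y))\<bar>\<^sup>2\<close> by
  \<open>4 - \<parallel>x + y\<parallel>\<^sup>2\<close>.  On the other hand \<open>\<bar>b (S (x - y))\<bar> \<ge> \<parallel>x - y\<parallel> / 2\<close>, since the error \<open>S - T\<close> is
  relative to \<open>\<parallel>x - y\<parallel>\<close>.  Hence the modulus of convexity is at least \<open>c / 32 * \<epsilon>\<^sup>2\<close>.
\<close>

section \<open>The Hahn-Banach theorem\<close>

text \<open>Homogeneity is asked only as an inequality for positive scalars;
  \<open>sub_scale\<close> recovers equality. The value 0 off the carrier makes equality of
  functions the same as equality on the carrier, which is what minimality in Zorn's lemma refers
  to.\<close>

definition sublinear_on :: "'a nspace \<Rightarrow> ('a \<Rightarrow> real) \<Rightarrow> bool" where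
  "sublinear_on X q \<longleftrightarrow>
     (\<forall>x\<in>carrier X. \<forall>y\<in>carrier X. q (x \<oplus>\<^bsub>X\<^esub> y) \<le> q x + q y) \<and>
     (\<forall>t>0. \<forall>x\<in>carrier X. q (complex_of_real t \<odot>\<^bsub>X\<^esub> x) \<le> t * q x) \<and>
     (\<forall>x\<in>carrier X. q x \<le> vnorm X x) \<and>
     (\<forall>x. x \<notin> carrier X \<longrightarrow> q x = 0)"

text \<open>If \<open>q\<close> is a minimal sublinear functional, then \<open>shift X q y = q\<close> for every \<open>y\<close>, which forces
  \<open>q\<close> to be linear.\<close>

definition shift :: "'a nspace \<Rightarrow> ('a \<Rightarrow> real) \<Rightarrow> 'a \<Rightarrow> 'a \<Rightarrow> real" where
  "shift X q y x = (if x \<in> carrier X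
     then INF t\<in>{0..}. q (x \<oplus>\<^bsub>X\<^esub> complex_of_real t \<odot>\<^bsub>X\<^esub> y) - t * q y else 0)"

locale normed_vs_over_reals = normed_vs +
  assumes Reals_subset: "\<real> \<subseteq> K"
begin

lemma of_real_in [simp]: "complex_of_real t \<in> K"
  using Reals_subset by auto

lemma smult_add: "a \<in> K \<Longrightarrow> b \<in> K \<Longrightarrow> x \<in> carrier X \<Longrightarrow> (a + b) \<odot> x = a \<odot> x \<oplus> b \<odot> x"
  using smult_l_distr[of a b x] by (simp add: scalar_ring_def)

lemma smult_mult: "a \<in> K \<Longrightarrow> b \<in> K \<Longrightarrow> x \<in> carrier X \<Longrightarrow> (a * b) \<odot> x = a \<odot> (b \<odot> x)"
  using smult_assoc1[of a b x] by (simp add: scalar_ring_def)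

lemma smult_1 [simp]: "x \<in> carrier X \<Longrightarrow> 1 \<odot> x = x"
  using smult_one[of x] by (simp add: scalar_ring_def)

lemma smult_0 [simp]: "x \<in> carrier X \<Longrightarrow> 0 \<odot> x = \<zero>"
  using smult_l_null[of x] by (simp add: scalar_ring_def)

lemma smult_zero [simp]: "a \<in> K \<Longrightarrow> a \<odot> \<zero> = \<zero>"
  using smult_r_null[of a] by (simp add: carrier_scalars)

declare vs_smult_closed [simp]

section \<open>Sublinear functionals and their shifts\<close>

context
  fixes q :: "'a \<Rightarrow> real"
  assumes q: "sublinear_on X q"
begin

lemma sub_add: "x \<in> carrier X \<Longrightarrow> y \<in> carrier X \<Longrightarrow> q (x \<oplus> y) \<le> q x + q y"
  and sub_scale_le: "t > 0 \<Longrightarrow> x \<in> carrier X \<Longrightarrow> q (complex_of_real t \<odot> x) \<le> t * q x"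
  and sub_le_norm: "x \<in> carrier X \<Longrightarrow> q x \<le> vnorm X x"
  and sub_outside: "x \<notin> carrier X \<Longrightarrow> q x = 0"
  using q by (auto simp: sublinear_on_def)

lemma sub_zero: "q \<zero> = 0"
  using sub_le_norm[of \<zero>] vnorm_zero sub_add[of \<zero> \<zero>] by simp

text \<open>Scaling back by \<open>inverse t\<close> gives the inequality that the definition
  omits.\<close>

lemma sub_scale:
  assumes "t \<ge> 0" "x \<in> carrier X" shows "q (complex_of_real t \<odot> x) = t * q x"
proof (cases "t = 0")
  case True
  then show ?thesis using assms by (simp add: sub_zero)
next
  case False
  then have t: "t > 0" using assms by simp
  have "x = complex_of_real (inverse t) \<odot> (complex_of_real t \<odot> x)"
    using assms t smult_mult[of "complex_of_real (inverse t)" "complex_of_real t" x]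
    by (simp flip: of_real_mult del: of_real_inverse)
  then have "q x \<le> inverse t * q (complex_of_real t \<odot> x)"
    using sub_scale_le[of "inverse t" "complex_of_real t \<odot> x"] t assms by simp
  then have "t * q x \<le> q (complex_of_real t \<odot> x)"
    using t by (simp add: field_simps)
  with sub_scale_le[OF t assms(2)] show ?thesis by simp
qed

lemma sub_ge_neg: "x \<in> carrier X \<Longrightarrow> - q (\<ominus> x) \<le> q x"
  using sub_add[of x "\<ominus> x"] by (simp add: r_neg sub_zero)

text \<open>Subadditivity is applied to \<open>t y = (x + t y) - x\<close>, where
  \<open>q (t y) = t * q y\<close>. Hence the infimum in \<open>shift\<close> is over a set bounded
  below, as a real infimum requires.\<close>

lemma shift_bdd:
  assumes "x \<in> carrier X" "y \<in> carrier X"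
  shows "t \<ge> 0 \<Longrightarrow> - q (\<ominus> x) \<le> q (x \<oplus> complex_of_real t \<odot> y) - t * q y"
    and "bdd_below ((\<lambda>t. q (x \<oplus> complex_of_real t \<odot> y) - t * q y) ` {0..})"
proof -
  show *: "- q (\<ominus> x) \<le> q (x \<oplus> complex_of_real t \<odot> y) - t * q y" if "t \<ge> 0" for t
  proof -
    have "complex_of_real t \<odot> y = (x \<oplus> complex_of_real t \<odot> y) \<oplus> \<ominus> x"
      using assms by (metis a_comm a_assoc a_inv_closed r_neg1 vs_smult_closed of_real_in a_closed)
    then have "q (complex_of_real t \<odot> y) \<le> q (x \<oplus> complex_of_real t \<odot> y) + q (\<ominus> x)"
      using sub_add[of "x \<oplus> complex_of_real t \<odot> y" "\<ominus> x"] assms by simp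
    then show ?thesis using sub_scale[OF that assms(2)] by simp
  qed
  then show "bdd_below ((\<lambda>t. q (x \<oplus> complex_of_real t \<odot> y) - t * q y) ` {0..})"
    by (intro bdd_belowI2[of _ "- q (\<ominus> x)"]) auto
qed

lemma shift_le:
  assumes "x \<in> carrier X" "y \<in> carrier X" "t \<ge> 0"
  shows "shift X q y x \<le> q (x \<oplus> complex_of_real t \<odot> y) - t * q y"
  unfolding shift_def using assms shift_bdd(2)[OF assms(1,2)] by (auto intro!: cINF_lower)

lemma shift_geI:
  assumes "x \<in> carrier X" "\<And>t. t \<ge> 0 \<Longrightarrow> b \<le> q (x \<oplus> complex_of_real t \<odot> y) - t * q y"
  shows "b \<le> shift X q y x"
  unfolding shift_def using assms by (auto intro!: cINF_greatest)

lemma shift_le_self: "y \<in> carrier X \<Longrightarrow> shift X q y x \<le> q x"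
  using shift_le[of x y 0] sub_outside[of x] by (cases "x \<in> carrier X") (auto simp: shift_def)

text \<open>The parameter \<open>t = 1\<close> makes the argument vanish. Applied to the norm, this
  provides a first functional with the required value at \<open>\<ominus> w\<close>; applied to a
  minimal functional, it yields oddness.\<close>

lemma shift_uminus: "y \<in> carrier X \<Longrightarrow> shift X q y (\<ominus> y) \<le> - q y"
  using shift_le[of "\<ominus> y" y 1] by (simp add: l_neg sub_zero)

text \<open>Parameters \<open>s\<close> for \<open>x\<close> and \<open>t\<close> for
  \<open>x'\<close> combine to \<open>s + t\<close> for \<open>x \<oplus> x'\<close>, and
  \<open>t\<close> for \<open>x\<close> becomes \<open>r * t\<close> for \<open>r\<close> times
  \<open>x\<close>. Taking infima over one parameter at a time gives both inequalities.\<close>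

lemma shift_sublinear:
  assumes y: "y \<in> carrier X"
  shows "sublinear_on X (shift X q y)"
  unfolding sublinear_on_def
proof (intro conjI ballI allI impI)
  fix x x' assume x: "x \<in> carrier X" and x': "x' \<in> carrier X"
  have "shift X q y (x \<oplus> x') - (q (x' \<oplus> complex_of_real t \<odot> y) - t * q y)
      \<le> q (x \<oplus> complex_of_real s \<odot> y) - s * q y" if "s \<ge> 0" "t \<ge> 0" for s t
  proof -
    have "(x \<oplus> x') \<oplus> complex_of_real (s + t) \<odot> y
        = (x \<oplus> complex_of_real s \<odot> y) \<oplus> (x' \<oplus> complex_of_real t \<odot> y)"
      using x x' y by (simp add: smult_add a_ac)
    then show ?thesis
      using shift_le[of "x \<oplus> x'" y "s + t"] x x' y that
        sub_add[of "x \<oplus> complex_of_real s \<odot> y" "x' \<oplus> complex_of_real t \<odot> y"]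
      by (simp add: algebra_simps)
  qed
  then have "shift X q y (x \<oplus> x') - (q (x' \<oplus> complex_of_real t \<odot> y) - t * q y) \<le> shift X q y x"
    if "t \<ge> 0" for t
    using that by (intro shift_geI x) auto
  then have "shift X q y (x \<oplus> x') - shift X q y x \<le> shift X q y x'"
    by (intro shift_geI x') (simp add: algebra_simps)
  then show "shift X q y (x \<oplus> x') \<le> shift X q y x + shift X q y x'" by simp
next
  fix r :: real and x assume r: "r > 0" and x: "x \<in> carrier X"
  have "inverse r * shift X q y (complex_of_real r \<odot> x) \<le> shift X q y x"
  proof (rule shift_geI[OF x])
    fix t :: real assume t: "t \<ge> 0"
    have eq: "complex_of_real r \<odot> x \<oplus> complex_of_real (r * t) \<odot> y
        = complex_of_real r \<odot> (x \<oplus> complex_of_real t \<odot> y)"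
      using x y by (simp add: vs_smult_r_distr smult_mult)
    have "shift X q y (complex_of_real r \<odot> x)
        \<le> q (complex_of_real r \<odot> (x \<oplus> complex_of_real t \<odot> y)) - (r * t) * q y"
      using shift_le[of "complex_of_real r \<odot> x" y "r * t"] x y r t by (simp only: eq) simp
    also have "\<dots> = r * (q (x \<oplus> complex_of_real t \<odot> y) - t * q y)"
      using sub_scale[of r "x \<oplus> complex_of_real t \<odot> y"] r x y by (simp add: algebra_simps)
    finally show "inverse r * shift X q y (complex_of_real r \<odot> x)
        \<le> q (x \<oplus> complex_of_real t \<odot> y) - t * q y"
      using r by (simp add: field_simps)
  qed
  then show "shift X q y (complex_of_real r \<odot> x) \<le> r * shift X q y x"
    using r by (simp add: field_simps)
next
  fix x assume "x \<in> carrier X"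
  then show "shift X q y x \<le> vnorm X x"
    using shift_le_self[OF y, of x] sub_le_norm[of x] by simp
qed (simp add: shift_def)

end

section \<open>Minimal sublinear functionals and norming functionals\<close>

lemma norm_sublinear: "sublinear_on X (\<lambda>x. if x \<in> carrier X then vnorm X x else 0)"
  by (simp add: sublinear_on_def vnorm_triangle vnorm_smult)

text \<open>In a chain, any two members \<open>p\<close> and \<open>q\<close> lie above a common
  member \<open>m\<close>, so \<open>m (x \<oplus> y) \<le> p x + q y\<close>; this makes the
  infimum subadditive. The values are bounded below since
  \<open>q x \<ge> - q (\<ominus> x) \<ge> - vnorm X x\<close>.\<close>

lemma sublinear_INF:
  assumes "C \<noteq> {}" and sub: "\<And>q. q \<in> C \<Longrightarrow> sublinear_on X q"
    and chain: "\<And>p q. p \<in> C \<Longrightarrow> q \<in> C \<Longrightarrow> p \<le> q \<or> q \<le> p"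
  shows "sublinear_on X (\<lambda>x. INF q\<in>C. q x)" and "q \<in> C \<Longrightarrow> (\<lambda>x. INF q\<in>C. q x) \<le> q"
proof -
  have bdd: "bdd_below ((\<lambda>q. q x) ` C)" for x
  proof (rule bdd_belowI2)
    fix q assume "q \<in> C"
    then have q: "sublinear_on X q" by (rule sub)
    show "(if x \<in> carrier X then - vnorm X x else 0) \<le> q x"
      using sub_ge_neg[OF q, of x] sub_le_norm[OF q, of "\<ominus> x"] sub_outside[OF q, of x]
      by (auto simp: vnorm_uminus)
  qed
  have low: "(INF q\<in>C. q x) \<le> q x" if "q \<in> C" for q x
    using bdd that by (rule cINF_lower)
  then show "q \<in> C \<Longrightarrow> (\<lambda>x. INF q\<in>C. q x) \<le> q" by (simp add: le_fun_def)
  show "sublinear_on X (\<lambda>x. INF q\<in>C. q x)"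
    unfolding sublinear_on_def
  proof (intro conjI ballI allI impI)
    fix x y assume x: "x \<in> carrier X" and y: "y \<in> carrier X"
    have "(INF q\<in>C. q (x \<oplus> y)) \<le> p x + q y" if p: "p \<in> C" and q: "q \<in> C" for p q
    proof -
      obtain m where "m \<in> C" "m \<le> p" "m \<le> q" using chain[OF p q] p q by auto
      then show ?thesis
        using low[of m "x \<oplus> y"] sub_add[OF sub, of m x y] x y
          le_funD[of m p x] le_funD[of m q y] by linarith
    qed
    then have "(INF q\<in>C. q (x \<oplus> y)) - q y \<le> (INF p\<in>C. p x)" if "q \<in> C" for q
      using that \<open>C \<noteq> {}\<close> by (intro cINF_greatest) (auto simp: algebra_simps)
    then have "(INF q\<in>C. q (x \<oplus> y)) - (INF p\<in>C. p x) \<le> (INF q\<in>C. q y)"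
      using \<open>C \<noteq> {}\<close> by (intro cINF_greatest) (auto simp: algebra_simps)
    then show "(INF q\<in>C. q (x \<oplus> y)) \<le> (INF q\<in>C. q x) + (INF q\<in>C. q y)" by simp
  next
    fix t :: real and x assume t: "t > 0" and x: "x \<in> carrier X"
    have "inverse t * (INF q\<in>C. q (complex_of_real t \<odot> x)) \<le> (INF q\<in>C. q x)"
    proof (rule cINF_greatest[OF \<open>C \<noteq> {}\<close>])
      fix q assume q: "q \<in> C"
      show "inverse t * (INF q\<in>C. q (complex_of_real t \<odot> x)) \<le> q x"
        using low[OF q, of "complex_of_real t \<odot> x"] sub_scale_le[OF sub[OF q] t x] t
        by (simp add: field_simps)
    qed
    then show "(INF q\<in>C. q (complex_of_real t \<odot> x)) \<le> t * (INF q\<in>C. q x)"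
      using t by (simp add: field_simps)
  next
    obtain q where q: "q \<in> C" using \<open>C \<noteq> {}\<close> by auto
    fix x assume "x \<in> carrier X"
    then show "(INF q\<in>C. q x) \<le> vnorm X x"
      using low[OF q, of x] sub_le_norm[OF sub[OF q]] by (meson order_trans)
  next
    fix x assume "x \<notin> carrier X"
    then have "(\<lambda>q. q x) ` C = {0}" using \<open>C \<noteq> {}\<close> sub_outside[OF sub] by force
    then show "(INF q\<in>C. q x) = 0" by simp
  qed
qed

text \<open>Zorn's lemma gives a minimal functional among the sublinear ones with value at most
  \<open>- vnorm X w\<close> at \<open>\<ominus> w\<close>. It is odd because its shifts stay in
  this family, and an odd sublinear functional is linear. Oddness also turns the value at
  \<open>\<ominus> w\<close> into the lower bound at \<open>w\<close>.\<close>

lemma real_norming_functional: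
  assumes w: "w \<in> carrier X"
  obtains u where
    "\<And>x y. x \<in> carrier X \<Longrightarrow> y \<in> carrier X \<Longrightarrow> u (x \<oplus> y) = u x + u y"
    "\<And>t x. x \<in> carrier X \<Longrightarrow> u (complex_of_real t \<odot> x) = t * u x"
    "\<And>x. x \<in> carrier X \<Longrightarrow> u x \<le> vnorm X x"
    "vnorm X w \<le> u w"
proof -
  define A where "A = {q. sublinear_on X q \<and> q (\<ominus> w) \<le> - vnorm X w}"
  let ?p = "\<lambda>x. if x \<in> carrier X then vnorm X x else 0"
  \<comment> \<open>The order is reversed, so the bound that Zorn's lemma asks for is the pointwise
    infimum of a chain.\<close>
  have "\<exists>m\<in>A. \<forall>q\<in>A. m \<ge> q \<longrightarrow> q = m"
  proof (rule predicate_Zorn)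
    show "partial_order_on A (relation_of (\<lambda>p q. p \<ge> q) A)"
      by (rule partial_order_on_relation_ofI) auto
    fix C assume C: "C \<in> Chains (relation_of (\<lambda>p q. p \<ge> q) A)"
    then have CA: "C \<subseteq> A" by (rule Chains_relation_of)
    show "\<exists>u\<in>A. \<forall>a\<in>C. u \<le> a"
    proof (cases "C = {}")
      case True
      \<comment> \<open>The empty chain requires \<open>A\<close> to be nonempty; the norm shifted
        along \<open>w\<close> is a member.\<close>
      have "shift X ?p w \<in> A"
        using shift_sublinear[OF norm_sublinear w] shift_uminus[OF norm_sublinear w] w
        by (simp add: A_def)
      then show ?thesis using True by auto
    next
      case False
      have sub: "sublinear_on X q" "q (\<ominus> w) \<le> - vnorm X w" if "q \<in> C" for q
        using that CA by (auto simp: A_def)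
      have chain: "p \<le> q \<or> q \<le> p" if "p \<in> C" "q \<in> C" for p q
        using C that by (auto simp: Chains_def relation_of_def)
      note I = sublinear_INF[OF False sub(1) chain]
      obtain q where "q \<in> C" using False by auto
      then have "(INF q\<in>C. q (\<ominus> w)) \<le> - vnorm X w"
        using le_funD[OF I(2)[of q], of "\<ominus> w"] sub(2)[of q] by simp
      then have "(\<lambda>x. INF q\<in>C. q x) \<in> A" using I(1) by (simp add: A_def)
      then show ?thesis using I(2) by blast
    qed
  qed
  then obtain u where u: "sublinear_on X u" "u (\<ominus> w) \<le> - vnorm X w"
    and min: "\<And>q. q \<in> A \<Longrightarrow> q \<le> u \<Longrightarrow> q = u"
    by (auto simp: A_def)
  have neg: "u (\<ominus> y) = - u y" if y: "y \<in> carrier X" for y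
  proof -
    have "shift X u y \<in> A"
      using shift_sublinear[OF u(1) y] shift_le_self[OF u(1) y, of "\<ominus> w"] u(2) by (simp add: A_def)
    moreover have "shift X u y \<le> u" using shift_le_self[OF u(1) y] by (simp add: le_fun_def)
    ultimately have "shift X u y = u" by (rule min)
    then show ?thesis using shift_uminus[OF u(1) y] sub_ge_neg[OF u(1) y] by simp
  qed
  show thesis
  proof
    fix x y assume x: "x \<in> carrier X" and y: "y \<in> carrier X"
    have "(x \<oplus> y) \<oplus> \<ominus> y = x" using x y by (simp add: a_assoc r_neg)
    then have "u x \<le> u (x \<oplus> y) - u y"
      using sub_add[OF u(1), of "x \<oplus> y" "\<ominus> y"] neg[OF y] x y by simp
    then show "u (x \<oplus> y) = u x + u y" using sub_add[OF u(1) x y] by simp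
  next
    fix t :: real and x assume x: "x \<in> carrier X"
    show "u (complex_of_real t \<odot> x) = t * u x"
    proof (cases "t \<ge> 0")
      case True
      then show ?thesis by (rule sub_scale[OF u(1) _ x])
    next
      case False
      have "complex_of_real t \<odot> x = \<ominus> (complex_of_real (- t) \<odot> x)"
        using x minus_one_in smult_mult[of "-1" "complex_of_real (-t)" x]
        by (simp add: uminus_smult del: of_real_minus) simp
      then show ?thesis
        using neg[of "complex_of_real (-t) \<odot> x"] of_real_in[of "-t"]
          sub_scale[OF u(1), of "-t" x] False x
        by simp
    qed
  next
    fix x assume "x \<in> carrier X"
    then show "u x \<le> vnorm X x" by (rule sub_le_norm[OF u(1)])
  next
    show "vnorm X w \<le> u w" using neg[OF w] u(2) by simp
  qed
qed

text \<open>A real norming functional \<open>u\<close> serves directly for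
  \<open>K = \<real>\<close>, with the absolute value controlled by testing \<open>x\<close> and its
  negative. For \<open>K = UNIV\<close> it becomes the real part of the complex linear functional
  \<open>u x - \<i> * u (\<i> x)\<close>.\<close>

lemma norming_functional:
  assumes K: "K = \<real> \<or> K = UNIV" and w: "w \<in> carrier X"
  obtains g :: "'a \<Rightarrow> complex" where
    "\<And>x y. x \<in> carrier X \<Longrightarrow> y \<in> carrier X \<Longrightarrow> g (x \<oplus> y) = g x + g y"
    "\<And>a x. a \<in> K \<Longrightarrow> x \<in> carrier X \<Longrightarrow> g (a \<odot> x) = a * g x"
    "\<And>x. x \<in> carrier X \<Longrightarrow> cmod (g x) \<le> vnorm X x"
    "vnorm X w \<le> cmod (g w)"
proof -
  obtain u where add: "\<And>x y. x \<in> carrier X \<Longrightarrow> y \<in> carrier X \<Longrightarrow> u (x \<oplus> y) = u x + u y"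
    and scale: "\<And>t x. x \<in> carrier X \<Longrightarrow> u (complex_of_real t \<odot> x) = t * u x"
    and le: "\<And>x. x \<in> carrier X \<Longrightarrow> u x \<le> vnorm X x" and norming: "vnorm X w \<le> u w"
    using real_norming_functional[OF w] by metis
  from K show thesis
  proof
    assume KR: "K = \<real>"
    show thesis
    proof (rule that[of "\<lambda>x. complex_of_real (u x)"])
      fix x assume x: "x \<in> carrier X"
      have "u ((-1) \<odot> x) = - u x" using scale[OF x, of "-1"] by simp
      then show "cmod (complex_of_real (u x)) \<le> vnorm X x"
        using le[OF x] le[of "(-1) \<odot> x"] x by (simp add: vnorm_smult minus_one_in)
    qed (use KR add scale norming in \<open>auto elim!: Reals_cases\<close>)
  next
    assume KU: "K = UNIV"
    define g where "g x = Complex (u x) (- u (\<i> \<odot> x))" for x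
    have c: "a \<odot> x \<in> carrier X" if "x \<in> carrier X" for a x using that KU by simp
    have g_add: "g (x \<oplus> y) = g x + g y" if "x \<in> carrier X" "y \<in> carrier X" for x y
      using that KU by (simp add: g_def add vs_smult_r_distr c complex_eq_iff)
    have g_scale: "g (a \<odot> x) = a * g x" if x: "x \<in> carrier X" for a x
    proof -
      have "(\<i> * \<i>) \<odot> x = complex_of_real (-1) \<odot> x" by simp
      then have ii: "\<i> \<odot> (\<i> \<odot> x) = complex_of_real (-1) \<odot> x"
        using smult_mult[of \<i> \<i> x] KU x by simp
      have a: "a \<odot> x = complex_of_real (Re a) \<odot> x \<oplus> complex_of_real (Im a) \<odot> (\<i> \<odot> x)"
        using smult_add[of "complex_of_real (Re a)" "complex_of_real (Im a) * \<i>" x]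
          smult_mult[of "complex_of_real (Im a)" \<i> x] KU x
        by (simp add: complex_eq[of a, symmetric] mult.commute)
      have ia: "\<i> \<odot> (a \<odot> x) = complex_of_real (Re a) \<odot> (\<i> \<odot> x) \<oplus> complex_of_real (Im a) \<odot> (\<i> \<odot> (\<i> \<odot> x))"
        using x KU smult_mult[of \<i> "complex_of_real (Re a)" x] smult_mult[of "complex_of_real (Re a)" \<i> x]
          smult_mult[of \<i> "complex_of_real (Im a)" "\<i> \<odot> x"] smult_mult[of "complex_of_real (Im a)" \<i> "\<i> \<odot> x"]
        by (simp add: a vs_smult_r_distr mult.commute)
      have ua: "u (a \<odot> x) = Re a * u x + Im a * u (\<i> \<odot> x)"
        unfolding a using x by (simp add: add scale c)
      have uia: "u (\<i> \<odot> (a \<odot> x)) = Re a * u (\<i> \<odot> x) - Im a * u x"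
        unfolding ia ii using x by (simp add: add scale c del: of_real_minus)
      show ?thesis
        unfolding g_def by (simp add: complex_eq_iff ua uia)
    qed
    show thesis
    proof (rule that[of g])
      fix x assume x: "x \<in> carrier X"
      \<comment> \<open>After a rotation the value \<open>g (\<theta> x)\<close> is real and equals
        \<open>u (\<theta> x)\<close>, while the norm of the vector is unchanged.\<close>
      have "\<exists>\<theta>. cmod \<theta> = 1 \<and> \<theta> * g x = complex_of_real (cmod (g x))"
      proof (cases "g x = 0")
        case False
        then show ?thesis
          by (intro exI[of _ "cnj (g x) / cmod (g x)"])
            (use complex_norm_square[of "g x"] in
              \<open>simp add: norm_divide power2_eq_square mult.commute nonzero_divide_eq_eq\<close>)
      qed (auto intro: exI[of _ 1])
      then obtain \<theta> where \<theta>: "cmod \<theta> = 1" "\<theta> * g x = complex_of_real (cmod (g x))" by blast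
      have "cmod (g x) = Re (g (\<theta> \<odot> x))" using \<theta> g_scale[OF x] by simp
      also have "\<dots> \<le> vnorm X (\<theta> \<odot> x)" using le[OF c[OF x]] by (simp add: g_def)
      finally show "cmod (g x) \<le> vnorm X x" using \<theta> x KU by (simp add: vnorm_smult)
    next
      show "vnorm X w \<le> cmod (g w)"
        using norming complex_Re_le_cmod[of "g w"] by (simp add: g_def)
    qed (use g_add g_scale in auto)
  qed
qed

end

section \<open>The range space\<close>

definition cscale :: "complex \<Rightarrow> complex \<times> complex \<Rightarrow> complex \<times> complex" where
  "cscale a p = (a * fst p, a * snd p)"

text \<open>This linear map carries the weighted Euclidean norm to the standard one, so the
  parallelogram law of the inner product on pairs applies to it.\<close>

definition stretch :: "real \<Rightarrow> complex \<times> complex \<Rightarrow> complex \<times> complex" where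
  "stretch c p = (complex_of_real (sqrt (1 - c)) * fst p, complex_of_real (sqrt c) * snd p)"

text \<open>The second term keeps the norm from degenerating in the second coordinate as
  \<open>c\<close> tends to 0. The factor \<open>1/2\<close> is small enough that this term stays
  inactive at the points where norms are attained later.\<close>

definition wnorm :: "real \<Rightarrow> complex \<times> complex \<Rightarrow> real" where
  "wnorm c p = max (norm (stretch c p)) (cmod (snd p) / 2)"

lemma snd_cscale [simp]: "snd (cscale a p) = a * snd p"
  by (simp add: cscale_def)

lemma norm_cscale: "norm (cscale a p) = cmod a * norm p"
  by (simp add: cscale_def norm_prod_def norm_mult power_mult_distrib real_sqrt_mult
      flip: distrib_left)

lemma stretch_add: "stretch c (p + q) = stretch c p + stretch c q"
  by (simp add: stretch_def algebra_simps)

lemma stretch_diff: "stretch c (p - q) = stretch c p - stretch c q"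
  by (simp add: stretch_def algebra_simps)

lemma stretch_cscale: "stretch c (cscale a p) = cscale a (stretch c p)"
  by (simp add: stretch_def cscale_def)

lemma norm_stretch:
  "0 \<le> c \<Longrightarrow> c \<le> 1 \<Longrightarrow> (norm (stretch c p))\<^sup>2 = (1 - c) * (cmod (fst p))\<^sup>2 + c * (cmod (snd p))\<^sup>2"
  by (simp add: stretch_def norm_prod_def norm_mult power_mult_distrib)

lemma wnorm_triangle: "wnorm c (p + q) \<le> wnorm c p + wnorm c q"
  using norm_triangle_ineq[of "stretch c p" "stretch c q"] norm_triangle_ineq[of "snd p" "snd q"]
  by (auto simp: wnorm_def stretch_add max_def)

lemma wnorm_cscale: "wnorm c (cscale a p) = cmod a * wnorm c p"
  by (simp add: wnorm_def stretch_cscale norm_cscale norm_mult max_mult_distrib_left)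

lemma wnorm_nonneg [simp]: "0 \<le> wnorm c p"
  by (simp add: wnorm_def le_max_iff_disj)

lemma wnorm_zero [simp]: "wnorm c 0 = 0"
  by (simp add: wnorm_def stretch_def)

lemma wnorm_le_norm:
  assumes "0 \<le> c" "c \<le> 1" shows "wnorm c p \<le> norm p"
proof -
  have "(1 - c) * (cmod (fst p))\<^sup>2 + c * (cmod (snd p))\<^sup>2 \<le> 1 * (cmod (fst p))\<^sup>2 + 1 * (cmod (snd p))\<^sup>2"
    using assms by (intro add_mono mult_right_mono) auto
  then have "(norm (stretch c p))\<^sup>2 \<le> (norm p)\<^sup>2"
    by (simp add: norm_stretch[OF assms]) (simp add: norm_prod_def)
  then have "norm (stretch c p) \<le> norm p" by (rule power2_le_imp_le) simp
  moreover have "cmod (snd p) \<le> norm p" using norm_snd_le[of "snd p" "fst p"] by simp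
  ultimately show ?thesis unfolding wnorm_def using norm_ge_zero[of p] by linarith
qed

text \<open>Each coordinate is at most twice the weighted norm. The constant does not depend on
  \<open>c\<close>, so it survives the supremum over all weights.\<close>

lemma norm_le_wnorm:
  assumes "0 \<le> c" "c \<le> 1/2" shows "norm p \<le> 4 * wnorm c p"
proof -
  have "(1/2)\<^sup>2 * (cmod (fst p))\<^sup>2 \<le> (1 - c) * (cmod (fst p))\<^sup>2"
    using assms by (intro mult_right_mono) (auto simp: power2_eq_square)
  also have "\<dots> \<le> (norm (stretch c p))\<^sup>2" using assms by (simp add: norm_stretch)
  finally have "(1/2 * cmod (fst p))\<^sup>2 \<le> (norm (stretch c p))\<^sup>2" by (simp only: power_mult_distrib)
  then have "1/2 * cmod (fst p) \<le> norm (stretch c p)" by (rule power2_le_imp_le) simp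
  moreover have "norm p \<le> cmod (fst p) + cmod (snd p)"
    using norm_Pair_le[of "fst p" "snd p"] by simp
  ultimately show ?thesis by (auto simp: wnorm_def max_def)
qed

section \<open>The sup-normed space over all weights\<close>

definition weight :: "nat \<Rightarrow> real" where
  "weight n = 1 / (real n + 4)"

text \<open>The bound \<open>1/4\<close> keeps the pair of functionals in
  \<open>midpoint_bound\<close> at operator norm at least \<open>3/4\<close>.\<close>

lemma weight_pos: "0 < weight n" and weight_le: "weight n \<le> 1/4"
  by (auto simp: weight_def field_simps)

lemma weight_bounds [simp]: "0 \<le> weight n" "weight n \<le> 1/2" "weight n \<le> 1"
  using weight_pos[of n] weight_le[of n] by auto

text \<open>Complex pairs serve for \<open>K = \<real>\<close> too: the space is then regarded as a real Banach space.\<close>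

definition seq_space :: "(nat \<Rightarrow>\<^sub>C (complex \<times> complex)) nspace" where
  "seq_space = \<lparr>carrier = UNIV, mult = (\<lambda>_. id), one = 0, zero = 0, add = (+),
     smult = (\<lambda>a u. Bcontfun (\<lambda>n. cscale a (apply_bcontfun u n))),
     vnorm = (\<lambda>u. SUP n. wnorm (weight n) (apply_bcontfun u n))\<rparr>"

lemma seq_space_simps [simp]:
  "carrier seq_space = UNIV" "\<zero>\<^bsub>seq_space\<^esub> = 0" "u \<oplus>\<^bsub>seq_space\<^esub> v = u + v"
  by (simp_all add: seq_space_def)

text \<open>Functions on the discrete space \<open>nat\<close> are continuous, so bounded continuous
  functions on it are just bounded sequences.\<close>

lemma bounded_seq_in_bcontfun:
  fixes f :: "nat \<Rightarrow> 'b::real_normed_vector"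
  assumes "\<And>n. norm (f n) \<le> B" shows "f \<in> bcontfun"
  by (rule bcontfun_normI[of _ B]) (use assms in auto)

lemma seq_space_smult [simp]:
  "apply_bcontfun (a \<odot>\<^bsub>seq_space\<^esub> u) n = cscale a (apply_bcontfun u n)"
proof -
  have "(\<lambda>n. cscale a (apply_bcontfun u n)) \<in> bcontfun"
    by (rule bounded_seq_in_bcontfun[of _ "cmod a * norm u"])
      (simp add: norm_cscale mult_left_mono norm_bounded)
  then show ?thesis by (simp add: seq_space_def Bcontfun_inverse)
qed

lemma coord_le_vnorm: "wnorm (weight n) (apply_bcontfun u n) \<le> vnorm seq_space u"
proof -
  have "bdd_above (range (\<lambda>n. wnorm (weight n) (apply_bcontfun u n)))"
    by (intro bdd_aboveI2[of _ _ "norm u"] order_trans[OF wnorm_le_norm norm_bounded]) simp_all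
  then show ?thesis using cSUP_upper[OF UNIV_I] by (simp add: seq_space_def)
qed

lemma vnorm_seq_space_le:
  "(\<And>n. wnorm (weight n) (apply_bcontfun u n) \<le> B) \<Longrightarrow> vnorm seq_space u \<le> B"
  by (auto simp: seq_space_def intro!: cSUP_least)

lemma vnorm_seq_space_le_norm: "vnorm seq_space u \<le> norm u"
  by (intro vnorm_seq_space_le order_trans[OF wnorm_le_norm norm_bounded]) simp_all

lemma norm_le_vnorm_seq_space: "norm u \<le> 4 * vnorm seq_space u"
proof (rule norm_bound)
  fix n
  show "norm (apply_bcontfun u n) \<le> 4 * vnorm seq_space u"
    using norm_le_wnorm[OF weight_bounds(1,2), of "apply_bcontfun u n" n] coord_le_vnorm[of n u]
    by linarith
qed

lemma abelian_group_seq_space: "abelian_group seq_space"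
  by (rule abelian_groupI) (auto simp: algebra_simps intro: exI[of _ "- _"])

lemma seq_space_minus [simp]: "u \<ominus>\<^bsub>seq_space\<^esub> v = u - v"
proof -
  interpret abelian_group seq_space by (rule abelian_group_seq_space)
  have "\<ominus>\<^bsub>seq_space\<^esub> v = - v" by (rule minus_equality) auto
  then show ?thesis by (simp add: a_minus_def)
qed

lemma vnorm_seq_space_smult: "vnorm seq_space (a \<odot>\<^bsub>seq_space\<^esub> u) = cmod a * vnorm seq_space u"
proof (cases "a = 0")
  case True
  then have "a \<odot>\<^bsub>seq_space\<^esub> u = 0" by (intro bcontfun_eqI) (simp add: cscale_def zero_prod_def)
  then show ?thesis using True by (simp add: seq_space_def)
next
  case False
  show ?thesis
  proof (rule antisym)
    show "vnorm seq_space (a \<odot>\<^bsub>seq_space\<^esub> u) \<le> cmod a * vnorm seq_space u"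
      by (rule vnorm_seq_space_le) (simp add: wnorm_cscale mult_left_mono coord_le_vnorm)
    have "vnorm seq_space u \<le> vnorm seq_space (a \<odot>\<^bsub>seq_space\<^esub> u) / cmod a"
    proof (rule vnorm_seq_space_le)
      fix n
      show "wnorm (weight n) (apply_bcontfun u n) \<le> vnorm seq_space (a \<odot>\<^bsub>seq_space\<^esub> u) / cmod a"
        using coord_le_vnorm[of n "a \<odot>\<^bsub>seq_space\<^esub> u"] False
        by (simp add: wnorm_cscale field_simps)
    qed
    then show "cmod a * vnorm seq_space u \<le> vnorm seq_space (a \<odot>\<^bsub>seq_space\<^esub> u)"
      using False by (simp add: field_simps)
  qed
qed

text \<open>The norm is equivalent to the standard supremum norm, with constants 1 and 4, so
  completeness carries over from uniform convergence of bounded sequences.\<close>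

lemma banach_space_seq_space:
  assumes K: "cring (scalar_ring K)"
  shows "banach_space K seq_space"
proof -
  have "module (scalar_ring K) seq_space"
    by (rule moduleI[OF K abelian_group_seq_space])
      (auto intro!: bcontfun_eqI simp: cscale_def algebra_simps scalar_ring_def)
  moreover have "normed_vs_axioms K seq_space"
  proof
    fix x y :: "nat \<Rightarrow>\<^sub>C (complex \<times> complex)"
    show pos: "0 \<le> vnorm seq_space x"
      using coord_le_vnorm[of 0 x] wnorm_nonneg order_trans by blast
    show "(vnorm seq_space x = 0) = (x = \<zero>\<^bsub>seq_space\<^esub>)"
      using norm_le_vnorm_seq_space[of x] vnorm_seq_space_le_norm[of x] pos by auto
    show "vnorm seq_space (x \<oplus>\<^bsub>seq_space\<^esub> y) \<le> vnorm seq_space x + vnorm seq_space y"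
      by (rule vnorm_seq_space_le)
        (simp add: order_trans[OF wnorm_triangle add_mono[OF coord_le_vnorm coord_le_vnorm]])
  qed (simp add: vnorm_seq_space_smult)
  moreover have "banach_space_axioms seq_space"
  proof
    fix s :: "nat \<Rightarrow> nat \<Rightarrow>\<^sub>C (complex \<times> complex)"
    assume C: "\<forall>e>0. \<exists>N. \<forall>m\<ge>N. \<forall>n\<ge>N. vnorm seq_space (s m \<ominus>\<^bsub>seq_space\<^esub> s n) < e"
    have "Cauchy s"
      unfolding Cauchy_def
    proof (intro allI impI)
      fix e :: real assume "e > 0"
      then obtain N where N: "\<And>m n. m \<ge> N \<Longrightarrow> n \<ge> N \<Longrightarrow> vnorm seq_space (s m - s n) < e/4"
        using C[rule_format, of "e/4"] by auto
      have "dist (s m) (s n) < e" if "m \<ge> N" "n \<ge> N" for m n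
        using N[OF that] norm_le_vnorm_seq_space[of "s m - s n"] by (simp add: dist_norm)
      then show "\<exists>N. \<forall>m\<ge>N. \<forall>n\<ge>N. dist (s m) (s n) < e" by blast
    qed
    then obtain g where "uniform_limit UNIV (\<lambda>n. apply_bcontfun (s n)) g sequentially"
      using uniformly_convergent_eq_cauchy[of "\<lambda>_. True" "\<lambda>n. apply_bcontfun (s n)"]
      unfolding Cauchy_def uniform_limit_sequentially_iff
      by (metis dist_fun_lt_imp_dist_val_lt)
    then obtain l where "s \<longlonglongrightarrow> l"
      using uniform_limit_bcontfunE[OF _ sequentially_bot] by metis
    then have lim: "(\<lambda>n. norm (s n - l)) \<longlonglongrightarrow> 0" by (simp add: LIM_zero_iff tendsto_norm_zero_iff)
    have "0 \<le> vnorm seq_space u" for u using norm_le_vnorm_seq_space[of u] norm_ge_zero[of u] by linarith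
    then have "(\<lambda>n. vnorm seq_space (s n - l)) \<longlonglongrightarrow> 0"
      by (intro tendsto_sandwich[OF _ _ tendsto_const lim]) (auto simp: vnorm_seq_space_le_norm)
    then show "\<exists>l\<in>carrier seq_space. (\<lambda>n. vnorm seq_space (s n \<ominus>\<^bsub>seq_space\<^esub> l)) \<longlonglongrightarrow> 0" by auto
  qed
  ultimately show ?thesis by (simp add: banach_space_def normed_vs_def)
qed

section \<open>Midpoints in the domain space\<close>

definition single :: "nat \<Rightarrow> complex \<times> complex \<Rightarrow> nat \<Rightarrow>\<^sub>C (complex \<times> complex)" where
  "single n p = Bcontfun (\<lambda>m. if m = n then p else 0)"

lemma apply_single [simp]: "apply_bcontfun (single n p) m = (if m = n then p else 0)"
proof -
  have "(\<lambda>m. if m = n then p else 0) \<in> bcontfun"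
    by (rule bounded_seq_in_bcontfun[of _ "norm p"]) simp
  then show ?thesis by (simp add: single_def Bcontfun_inverse)
qed

lemma vnorm_single: "vnorm seq_space (single n p) = wnorm (weight n) p"
proof (rule antisym)
  show "vnorm seq_space (single n p) \<le> wnorm (weight n) p"
    by (rule vnorm_seq_space_le) auto
  show "wnorm (weight n) p \<le> vnorm seq_space (single n p)"
    using coord_le_vnorm[of n "single n p"] by simp
qed

lemma single_in_bounded_ops:
  assumes "\<And>x y. x \<in> carrier X \<Longrightarrow> y \<in> carrier X \<Longrightarrow> f (x \<oplus>\<^bsub>X\<^esub> y) = f x + f y"
    and "\<And>x y. x \<in> carrier X \<Longrightarrow> y \<in> carrier X \<Longrightarrow> g (x \<oplus>\<^bsub>X\<^esub> y) = g x + g y"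
    and "\<And>a x. a \<in> K \<Longrightarrow> x \<in> carrier X \<Longrightarrow> f (a \<odot>\<^bsub>X\<^esub> x) = a * f x"
    and "\<And>a x. a \<in> K \<Longrightarrow> x \<in> carrier X \<Longrightarrow> g (a \<odot>\<^bsub>X\<^esub> x) = a * g x"
    and "\<And>x. x \<in> carrier X \<Longrightarrow> wnorm (weight n) (f x, g x) \<le> B * vnorm X x"
  shows "(\<lambda>x. single n (f x, g x)) \<in> bounded_ops K X seq_space"
  unfolding bounded_ops_def
  using assms by (auto intro!: bcontfun_eqI exI[of _ B] simp: cscale_def vnorm_single zero_prod_def)

section \<open>Differences and norms of bounded operators\<close>

lemma (in module) smult_r_diff:
  assumes "a \<in> carrier R" "x \<in> carrier M" "y \<in> carrier M"
  shows "a \<odot>\<^bsub>M\<^esub> (x \<ominus>\<^bsub>M\<^esub> y) = a \<odot>\<^bsub>M\<^esub> x \<ominus>\<^bsub>M\<^esub> a \<odot>\<^bsub>M\<^esub> y"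
  using assms smult_r_distr[of a x "\<ominus>\<^bsub>M\<^esub> y"] smult_r_minus[of a y] by (simp add: a_minus_def)

text \<open>This makes \<open>op_norm_bound\<close> applicable to the error \<open>S - T\<close>,
  whose norm is a real supremum.\<close>

lemma bounded_ops_diff:
  assumes Y: "normed_vs K Y" and S: "S \<in> bounded_ops K X Y" and T: "T \<in> bounded_ops K X Y"
  shows "(\<lambda>x. S x \<ominus>\<^bsub>Y\<^esub> T x) \<in> bounded_ops K X Y"
proof -
  interpret Y: normed_vs K Y by (rule Y)
  have c: "S x \<in> carrier Y" "T x \<in> carrier Y" if "x \<in> carrier X" for x
    using S T that by (auto simp: bounded_ops_def)
  obtain B where B: "\<And>x. x \<in> carrier X \<Longrightarrow> vnorm Y (S x) \<le> B * vnorm X x"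
    using S unfolding bounded_ops_def by blast
  obtain C where C: "\<And>x. x \<in> carrier X \<Longrightarrow> vnorm Y (T x) \<le> C * vnorm X x"
    using T unfolding bounded_ops_def by blast
  have "S (x \<oplus>\<^bsub>X\<^esub> y) \<ominus>\<^bsub>Y\<^esub> T (x \<oplus>\<^bsub>X\<^esub> y) = (S x \<ominus>\<^bsub>Y\<^esub> T x) \<oplus>\<^bsub>Y\<^esub> (S y \<ominus>\<^bsub>Y\<^esub> T y)"
    if "x \<in> carrier X" "y \<in> carrier X" for x y
    using S T that c by (simp add: bounded_ops_def a_minus_def Y.minus_add Y.a_ac)
  moreover have "S (a \<odot>\<^bsub>X\<^esub> x) \<ominus>\<^bsub>Y\<^esub> T (a \<odot>\<^bsub>X\<^esub> x) = a \<odot>\<^bsub>Y\<^esub> (S x \<ominus>\<^bsub>Y\<^esub> T x)"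
    if "a \<in> K" "x \<in> carrier X" for a x
    using S T that c Y.smult_r_diff[of a "S x" "T x"]
    by (simp add: bounded_ops_def Y.carrier_scalars)
  moreover have "vnorm Y (S x \<ominus>\<^bsub>Y\<^esub> T x) \<le> (B + C) * vnorm X x" if "x \<in> carrier X" for x
    using Y.vnorm_triangle[of "S x" "\<ominus>\<^bsub>Y\<^esub> T x"] B[OF that] C[OF that] c[OF that]
    by (simp add: a_minus_def Y.vnorm_uminus algebra_simps)
  ultimately show ?thesis
    using c by (auto simp: bounded_ops_def intro!: exI[of _ "B + C"])
qed

context normed_vs_over_reals
begin

lemma op_norm_bound:
  assumes Y: "normed_vs K Y" and R: "R \<in> bounded_ops K X Y" and z: "z \<in> carrier X"
  shows "vnorm Y (R z) \<le> op_norm X Y R * vnorm X z"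
proof -
  interpret Y: normed_vs K Y by (rule Y)
  obtain B where B: "\<And>x. x \<in> carrier X \<Longrightarrow> vnorm Y (R x) \<le> B * vnorm X x"
    using R unfolding bounded_ops_def by blast
  have "vnorm Y (R x) \<le> \<bar>B\<bar>" if "x \<in> unit_ball X" for x
  proof -
    have "x \<in> carrier X" "vnorm X x \<le> 1" using that by (auto simp: unit_ball_def)
    then have "B * vnorm X x \<le> \<bar>B\<bar> * 1" by (intro mult_mono) (auto simp: vnorm_nonneg)
    with B[OF \<open>x \<in> carrier X\<close>] show ?thesis by simp
  qed
  then have bdd: "bdd_above ((\<lambda>x. vnorm Y (R x)) ` unit_ball X)" by (intro bdd_aboveI2)
  show ?thesis
  proof (cases "vnorm X z = 0")
    case True
    then show ?thesis using B[OF z] by simp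
  next
    case False
    then have pos: "vnorm X z > 0" using vnorm_nonneg[OF z] by simp
    let ?a = "complex_of_real (1 / vnorm X z)"
    have "?a \<odot> z \<in> unit_ball X"
      using z pos by (simp add: unit_ball_def vnorm_smult norm_divide del: of_real_divide)
    then have "vnorm Y (R (?a \<odot> z)) \<le> op_norm X Y R"
      unfolding op_norm_def by (rule cSUP_upper[OF _ bdd])
    moreover have "R (?a \<odot> z) = ?a \<odot>\<^bsub>Y\<^esub> R z" "R z \<in> carrier Y"
      using R z of_real_in[of "1 / vnorm X z"] by (auto simp: bounded_ops_def)
    ultimately have "vnorm Y (R z) / vnorm X z \<le> op_norm X Y R"
      using pos Y.vnorm_smult[OF of_real_in[of "1 / vnorm X z"], of "R z"]
      by (simp add: norm_divide)
    then show ?thesis using pos by (simp add: field_simps)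
  qed
qed

lemma bounded_ops_minus:
  assumes Y: "normed_vs K Y" and R: "R \<in> bounded_ops K X Y"
    and x: "x \<in> carrier X" and y: "y \<in> carrier X"
  shows "R (x \<ominus> y) = R x \<ominus>\<^bsub>Y\<^esub> R y"
proof -
  interpret Y: normed_vs K Y by (rule Y)
  have "R y \<in> carrier Y" using R y by (auto simp: bounded_ops_def)
  then show ?thesis
    using R x y minus_one_in
    by (simp add: bounded_ops_def a_minus_def uminus_smult Y.uminus_smult)
qed


text \<open>The constant depends on \<open>X\<close> only through the choice of \<open>n\<close>,
  hence through \<open>\<eta>\<close>, and not on \<open>x\<close> and \<open>y\<close>; the square
  is the source of the exponent 2.\<close>

lemma midpoint_bound:
  assumes K: "K = \<real> \<or> K = UNIV"
    and bpb: "\<And>T x0. T \<in> bounded_ops K X seq_space \<Longrightarrow> x0 \<in> unit_sphere X \<Longrightarrow>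
        op_norm X seq_space T = 1 \<Longrightarrow> vnorm seq_space (T x0) > 1 - \<eta> \<Longrightarrow>
        \<exists>S\<in>bounded_ops K X seq_space. op_norm X seq_space S = 1 \<and> vnorm seq_space (S x0) = 1 \<and>
           op_norm X seq_space (\<lambda>x. S x \<ominus>\<^bsub>seq_space\<^esub> T x) < 1/4"
    and n: "weight n < \<eta>" and x: "x \<in> unit_ball X" and y: "y \<in> unit_ball X"
  shows "weight n / 32 * (vnorm X (x \<ominus> y))\<^sup>2 \<le> 1 - vnorm X (x \<oplus> y) / 2"
proof -
  define c where "c = weight n"
  define r where "r = vnorm X (x \<oplus> y)"
  define d where "d = x \<ominus> y"
  have xy: "x \<in> carrier X" "y \<in> carrier X" "vnorm X x \<le> 1" "vnorm X y \<le> 1"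
    using x y by (auto simp: unit_ball_def)
  have dc: "d \<in> carrier X" and \<delta>0: "vnorm X d \<ge> 0" and \<delta>2: "vnorm X d \<le> 2"
    using xy vnorm_triangle[of x "\<ominus> y"] by (auto simp: d_def vnorm_nonneg a_minus_def vnorm_uminus)
  have c: "0 < c" "c \<le> 1/4" using weight_pos weight_le by (auto simp: c_def)
  have r: "0 \<le> r" "r \<le> 2" using xy vnorm_triangle[of x y] by (auto simp: r_def vnorm_nonneg)
  show ?thesis
  proof (cases "r = 0")
    case True
    \<comment> \<open>There is no \<open>x0\<close> when \<open>r = 0\<close>, but then
      \<open>vnorm X d \<le> 2\<close> and \<open>c \<le> 1/4\<close> suffice.\<close>
    have "(vnorm X d)\<^sup>2 \<le> 2\<^sup>2" by (intro power_mono \<delta>0 \<delta>2)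
    then have "c / 32 * (vnorm X d)\<^sup>2 \<le> (1/4) / 32 * 2\<^sup>2" using c by (intro mult_mono) auto
    then show ?thesis using True by (simp add: c_def r_def d_def)
  next
    case False
    then have r: "0 < r" "r \<le> 2" using r by auto
    define x0 where "x0 = complex_of_real (1 / r) \<odot> (x \<oplus> y)"
    have x0: "x0 \<in> carrier X" "vnorm X x0 = 1"
      using xy r of_real_in[of "1 / r"]
      by (simp_all add: x0_def vnorm_smult norm_divide r_def[symmetric] del: of_real_divide)
    have sx0: "x \<oplus> y = complex_of_real r \<odot> x0"
      using smult_mult[of "complex_of_real r" "complex_of_real (1 / r)" "x \<oplus> y"] xy r
      by (simp add: x0_def del: of_real_divide flip: of_real_mult)
    obtain f where f: "\<And>x y. x \<in> carrier X \<Longrightarrow> y \<in> carrier X \<Longrightarrow> f (x \<oplus> y) = f x + f y"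
      "\<And>a x. a \<in> K \<Longrightarrow> x \<in> carrier X \<Longrightarrow> f (a \<odot> x) = a * f x"
      "\<And>x. x \<in> carrier X \<Longrightarrow> cmod (f x) \<le> vnorm X x" "vnorm X x0 \<le> cmod (f x0)"
      using norming_functional[OF K x0(1)] by blast
    obtain g where g: "\<And>x y. x \<in> carrier X \<Longrightarrow> y \<in> carrier X \<Longrightarrow> g (x \<oplus> y) = g x + g y"
      "\<And>a x. a \<in> K \<Longrightarrow> x \<in> carrier X \<Longrightarrow> g (a \<odot> x) = a * g x"
      "\<And>x. x \<in> carrier X \<Longrightarrow> cmod (g x) \<le> vnorm X x" "vnorm X d \<le> cmod (g d)"
      using norming_functional[OF K dc] by blast
    define w where "w z = wnorm c (f z, g z)" for z
    have w_le: "w z \<le> vnorm X z" if z: "z \<in> carrier X" for z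
    proof -
      have "(norm (stretch c (f z, g z)))\<^sup>2 = (1 - c) * (cmod (f z))\<^sup>2 + c * (cmod (g z))\<^sup>2"
        using c by (simp add: norm_stretch)
      also have "\<dots> \<le> (1 - c) * (vnorm X z)\<^sup>2 + c * (vnorm X z)\<^sup>2"
        using c f(3)[OF z] g(3)[OF z] by (intro add_mono mult_left_mono power_mono) auto
      also have "\<dots> = (vnorm X z)\<^sup>2" by (simp add: algebra_simps)
      finally have "norm (stretch c (f z, g z)) \<le> vnorm X z"
        by (rule power2_le_imp_le) (rule vnorm_nonneg[OF z])
      then show ?thesis using g(3)[OF z] vnorm_nonneg[OF z] by (simp add: w_def wnorm_def)
    qed
    have w_x0: "1 - c \<le> w x0"
    proof -
      \<comment> \<open>As \<open>cmod (f x0) \<ge> 1\<close>, the squared Euclidean part is at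
        least \<open>1 - c\<close>, which dominates its own square; thus the loss at
        \<open>x0\<close> is at most \<open>c\<close>.\<close>
      have "(1 - c)\<^sup>2 \<le> (1 - c) * (cmod (f x0))\<^sup>2"
        using c f(4) x0(2) mult_mono[of "1 - c" "1 - c" "1 - c" "(cmod (f x0))\<^sup>2"]
          one_le_power[of "cmod (f x0)" 2]
        by (simp add: power2_eq_square)
      also have "\<dots> \<le> (norm (stretch c (f x0, g x0)))\<^sup>2" using c by (simp add: norm_stretch)
      finally have "1 - c \<le> norm (stretch c (f x0, g x0))" by (rule power2_le_imp_le) simp
      then show ?thesis by (simp add: w_def wnorm_def)
    qed
    \<comment> \<open>\<open>M\<close> is the norm of the operator given by \<open>(f, g)\<close>.
      Dividing by it makes the norm of \<open>T\<close> exactly 1, and since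
      \<open>M \<le> 1\<close> the value at \<open>x0\<close> does not decrease.\<close>
    define M where "M = (SUP z\<in>unit_ball X. w z)"
    have x0_ball: "x0 \<in> unit_ball X" using x0 by (simp add: unit_ball_def)
    have w_ball: "w z \<le> 1" if "z \<in> unit_ball X" for z
      using that w_le[of z] by (auto simp: unit_ball_def)
    have w_M: "w z \<le> M" if "z \<in> unit_ball X" for z
      unfolding M_def by (rule cSUP_upper[OF that bdd_aboveI2]) (rule w_ball)
    have "M \<le> 1" unfolding M_def by (rule cSUP_least) (use x0_ball w_ball in auto)
    moreover have "3/4 \<le> M" using w_M[OF x0_ball] w_x0 c by simp
    ultimately have M: "3/4 \<le> M" "M \<le> 1" by auto
    define l where "l = 1 / M"
    have l: "1 \<le> l" "l \<le> 4/3" "l * M = 1" using M by (auto simp: l_def field_simps)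
    define T where "T z = single n (complex_of_real l * f z, complex_of_real l * g z)" for z
    have T_norm: "wnorm (weight n) (complex_of_real l * f z, complex_of_real l * g z) = l * w z" for z
      using wnorm_cscale[of c l "(f z, g z)"] l by (simp add: cscale_def w_def c_def)
    have T: "T \<in> bounded_ops K X seq_space"
      unfolding T_def
      by (rule single_in_bounded_ops[where B = l])
        (use f g l w_le in \<open>auto simp: T_norm algebra_simps\<close>)
    have T_vnorm: "vnorm seq_space (T z) = l * w z" for z
      by (simp add: T_def vnorm_single T_norm)
    have "(SUP z\<in>unit_ball X. l * w z) = 1"
    proof (rule antisym)
      have *: "l * w z \<le> 1" if "z \<in> unit_ball X" for z
        using mult_left_mono[OF w_M[OF that], of l] l by simp
      then show "(SUP z\<in>unit_ball X. l * w z) \<le> 1"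
        by (intro cSUP_least) (use x0_ball in auto)
      \<comment> \<open>Multiplication by \<open>M = 1 / l\<close> turns an upper bound of
        \<open>l * w\<close> into one of \<open>w\<close>, so \<open>M\<close> is at most
        \<open>M\<close> times the supremum, and the positive \<open>M\<close> cancels.\<close>
      have "w z \<le> M * (SUP z\<in>unit_ball X. l * w z)" if "z \<in> unit_ball X" for z
      proof -
        have "l * w z \<le> (SUP z\<in>unit_ball X. l * w z)"
          by (rule cSUP_upper[OF that bdd_aboveI2]) (rule *)
        then show ?thesis using M by (simp add: l_def field_simps)
      qed
      then have "M \<le> M * (SUP z\<in>unit_ball X. l * w z)"
        using x0_ball unfolding M_def[symmetric] by (subst (1) M_def) (intro cSUP_least, auto)
      then show "1 \<le> (SUP z\<in>unit_ball X. l * w z)" using M by simp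
    qed
    then have "op_norm X seq_space T = 1" by (simp add: op_norm_def T_vnorm)
    moreover have "vnorm seq_space (T x0) > 1 - \<eta>"
      using w_x0 n l mult_right_mono[of 1 l "w x0"] c unfolding T_vnorm c_def by linarith
    ultimately obtain S where S: "S \<in> bounded_ops K X seq_space" "op_norm X seq_space S = 1"
      "vnorm seq_space (S x0) = 1" "op_norm X seq_space (\<lambda>x. S x \<ominus>\<^bsub>seq_space\<^esub> T x) < 1/4"
      using bpb[OF T] x0 by (auto simp: unit_sphere_def)
    have Y: "normed_vs K seq_space"
      using banach_space_seq_space R.is_cring by (simp add: banach_space_def)
    have diff: "wnorm (weight m) (apply_bcontfun (S z) m - apply_bcontfun (T z) m) \<le> vnorm X z / 4"
      if z: "z \<in> carrier X" for z m
    proof -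
      have "vnorm seq_space (S z - T z) \<le> op_norm X seq_space (\<lambda>x. S x \<ominus>\<^bsub>seq_space\<^esub> T x) * vnorm X z"
        using op_norm_bound[OF Y bounded_ops_diff[OF Y S(1) T] z] by simp
      also have "\<dots> \<le> 1/4 * vnorm X z"
        using S(4) vnorm_nonneg[OF z] by (intro mult_right_mono) auto
      finally show ?thesis using coord_le_vnorm[of m "S z - T z"] by simp
    qed
    define P where "P z = apply_bcontfun (S z) n" for z
    define Q where "Q z = stretch c (P z)" for z
    \<comment> \<open>The factor \<open>1/2\<close> in the second term of \<open>wnorm\<close>
      doubles the error \<open>1/4\<close>.\<close>
    have close: "cmod (snd (P z) - l * g z) \<le> vnorm X z / 2" if "z \<in> carrier X" for z
      using diff[OF that, of n] by (simp add: P_def T_def wnorm_def)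
    have Q_ball: "(norm (Q z))\<^sup>2 \<le> 1" if "z \<in> unit_ball X" for z
    proof -
      have z: "z \<in> carrier X" "vnorm X z \<le> 1" using that by (auto simp: unit_ball_def)
      have "norm (Q z) \<le> wnorm c (P z)" by (simp add: Q_def wnorm_def)
      also have "\<dots> \<le> vnorm seq_space (S z)" unfolding P_def c_def by (rule coord_le_vnorm)
      also have "\<dots> \<le> 1" using op_norm_bound[OF Y S(1) z(1)] S(2) z(2) by simp
      finally show ?thesis by (simp add: power_le_one)
    qed
    \<comment> \<open>In the other coordinates \<open>T\<close> vanishes, so \<open>S x0\<close> has
      size at most \<open>1/4\<close> there, and the norm 1 can only come from coordinate
      \<open>n\<close>.\<close>
    have "1 \<le> wnorm c (P x0)"
    proof (rule ccontr)
      assume "\<not> 1 \<le> wnorm c (P x0)"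
      moreover have "vnorm seq_space (S x0) \<le> max (1/4) (wnorm c (P x0))"
      proof (rule vnorm_seq_space_le)
        fix m
        show "wnorm (weight m) (apply_bcontfun (S x0) m) \<le> max (1/4) (wnorm c (P x0))"
          using diff[OF x0(1), of m] x0(2) by (cases "m = n") (auto simp: T_def P_def c_def)
      qed
      ultimately show False using S(3) by simp
    qed
    \<comment> \<open>The modulus is at most \<open>4/3 + 1/2 < 2\<close>, so the Euclidean part
      must be the one that attains the norm.\<close>
    moreover have "cmod (snd (P x0)) / 2 < 1"
    proof -
      have "l * cmod (g x0) \<le> 4/3 * 1" using l g(3)[OF x0(1)] x0(2) by (intro mult_mono) auto
      then show ?thesis
        using close[OF x0(1)] x0(2) l norm_triangle_sub[of "snd (P x0)" "l * g x0"]
        by (simp add: norm_mult)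
    qed
    ultimately have Q_x0: "1 \<le> norm (Q x0)" by (auto simp: wnorm_def Q_def max_def split: if_splits)
    have "P (x \<oplus> y) = P x + P y"
      using S(1) xy by (simp add: bounded_ops_def P_def)
    then have Q_sum: "Q (x \<oplus> y) = Q x + Q y" by (simp add: Q_def stretch_add)
    have "P (x \<oplus> y) = cscale (complex_of_real r) (P x0)"
      using S(1) x0(1) by (simp add: bounded_ops_def P_def sx0)
    then have "norm (Q (x \<oplus> y)) = r * norm (Q x0)"
      using r by (simp add: Q_def stretch_cscale norm_cscale)
    then have "r \<le> norm (Q x + Q y)" using Q_x0 r by (simp add: Q_sum)
    then have r_sq: "r\<^sup>2 \<le> (norm (Q x + Q y))\<^sup>2" using r by (intro power_mono) auto
    have "P d = P x - P y"
      using bounded_ops_minus[OF Y S(1) xy(1,2)] by (simp add: P_def d_def)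
    then have Q_diff: "Q d = Q x - Q y" by (simp add: Q_def stretch_diff)
    have "l * vnorm X d \<le> cmod (l * g d)" using g(4) l by (simp add: norm_mult mult_left_mono)
    moreover have "1 * vnorm X d \<le> l * vnorm X d" using l \<delta>0 by (intro mult_right_mono)
    \<comment> \<open>The main term is at least \<open>vnorm X d\<close> and the error at most half
      of it.\<close>
    ultimately have "vnorm X d / 2 \<le> cmod (snd (P d))"
      using close[OF dc] norm_triangle_ineq3[of "snd (P d)" "l * g d"] by simp
    then have "(vnorm X d / 2)\<^sup>2 \<le> (cmod (snd (P d)))\<^sup>2" using \<delta>0 by (intro power_mono) auto
    then have "c * (vnorm X d / 2)\<^sup>2 \<le> c * (cmod (snd (P d)))\<^sup>2" using c by simp
    also have "\<dots> \<le> (norm (Q d))\<^sup>2" using c by (simp add: Q_def norm_stretch)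
    \<comment> \<open>The parallelogram law for the real inner product on pairs of complex
      numbers.\<close>
    also have "\<dots> = 2 * (norm (Q x))\<^sup>2 + 2 * (norm (Q y))\<^sup>2 - (norm (Q x + Q y))\<^sup>2"
      unfolding Q_diff by (simp add: power2_norm_eq_inner inner_simps inner_commute)
    also have "\<dots> \<le> 4 - r\<^sup>2" using Q_ball[OF x] Q_ball[OF y] r_sq by simp
    also have "\<dots> = (2 + r) * (2 - r)" by (simp add: algebra_simps power2_eq_square)
    \<comment> \<open>The left end of the chain is \<open>c / 4\<close> times the squared distance,
      so division by 8 gives the constant \<open>c / 32\<close>.\<close>
    also have "\<dots> \<le> 4 * (2 - r)" using r by (intro mult_right_mono) auto
    finally show ?thesis by (simp add: c_def r_def d_def power_divide)
  qed
qed

end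

theorem theorem3p1:
  fixes K :: "complex set" and X :: "'a nspace"
  assumes "K = \<real> \<or> K = UNIV"
    and "banach_space K X"
    and "universal_pointwise_BPB_domain K X"
  shows "uniformly_convex X \<and>
    (\<exists>q C :: real. 2 \<le> q \<and> 0 < C \<and>
       (\<forall>\<epsilon>::real. 0 < \<epsilon> \<and> \<epsilon> < 2 \<longrightarrow> ereal (C * \<epsilon> powr q) \<le> modulus_convexity X \<epsilon>))"
proof -
  interpret X: banach_space K X by (rule assms(2))
  interpret X: normed_vs_over_reals K X by unfold_locales (use assms(1) in auto)
  have bpb: "pointwise_BPB K X seq_space"
    by (rule universal_pointwise_BPB_domainD[OF assms(2,3) banach_space_seq_space[OF X.R.is_cring]])
  have quarter: "0 < (1/4 :: real)" by simp
  obtain \<eta> where \<eta>: "\<eta> > 0"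
    "\<And>T x0. T \<in> bounded_ops K X seq_space \<Longrightarrow> x0 \<in> unit_sphere X \<Longrightarrow>
        op_norm X seq_space T = 1 \<Longrightarrow> vnorm seq_space (T x0) > 1 - \<eta> \<Longrightarrow>
        \<exists>S\<in>bounded_ops K X seq_space. op_norm X seq_space S = 1 \<and> vnorm seq_space (S x0) = 1 \<and>
           op_norm X seq_space (\<lambda>x. S x \<ominus>\<^bsub>seq_space\<^esub> T x) < 1/4"
    using bpb[unfolded pointwise_BPB_def, rule_format, OF quarter] by meson
  obtain n where "inverse (real (Suc n)) < \<eta>" using reals_Archimedean[OF \<eta>(1)] by blast
  moreover have "weight n \<le> inverse (real (Suc n))" by (simp add: weight_def field_simps)
  ultimately have n: "weight n < \<eta>" by simp
  define C where "C = weight n / 32"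
  have C: "0 < C" using weight_pos by (simp add: C_def)
  \<comment> \<open>All positive \<open>\<epsilon>\<close> are treated, since uniform convexity
    includes \<open>\<epsilon> = 2\<close>.\<close>
  have bound: "ereal (C * \<epsilon> powr 2) \<le> modulus_convexity X \<epsilon>" if \<epsilon>: "\<epsilon> > 0" for \<epsilon>
    unfolding modulus_convexity_def
  proof (rule Inf_greatest, clarify)
    fix x y assume xy: "x \<in> unit_ball X" "y \<in> unit_ball X" and ge: "vnorm X (x \<ominus>\<^bsub>X\<^esub> y) \<ge> \<epsilon>"
    have c: "x \<in> carrier X" "y \<in> carrier X" using xy by (auto simp: unit_ball_def)
    have half: "(1/2) \<in> K" using X.of_real_in[of "1/2"] by simp
    have "C * \<epsilon>\<^sup>2 \<le> C * (vnorm X (x \<ominus>\<^bsub>X\<^esub> y))\<^sup>2"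
      using C \<epsilon> ge by (intro mult_left_mono power_mono) auto
    also have "\<dots> \<le> 1 - vnorm X (x \<oplus>\<^bsub>X\<^esub> y) / 2"
      unfolding C_def by (rule X.midpoint_bound[OF assms(1) \<eta>(2) n xy])
    finally show "ereal (C * \<epsilon> powr 2) \<le> ereal (1 - vnorm X ((1/2) \<odot>\<^bsub>X\<^esub> (x \<oplus>\<^bsub>X\<^esub> y)))"
      using \<epsilon> c X.vnorm_smult[OF half, of "x \<oplus>\<^bsub>X\<^esub> y"] by simp
  qed
  have "uniformly_convex X"
    unfolding uniformly_convex_def
  proof
    fix \<epsilon> :: real assume "\<epsilon> \<in> {0<..2}"
    then have "0 < ereal (C * \<epsilon> powr 2)" "\<epsilon> > 0" using C by auto
    then show "modulus_convexity X \<epsilon> > 0" using bound[of \<epsilon>] by (meson less_le_trans)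
  qed
  moreover have "\<exists>q C :: real. 2 \<le> q \<and> 0 < C \<and>
       (\<forall>\<epsilon>::real. 0 < \<epsilon> \<and> \<epsilon> < 2 \<longrightarrow> ereal (C * \<epsilon> powr q) \<le> modulus_convexity X \<epsilon>)"
    using C bound by (intro exI[of _ 2] exI[of _ C]) auto
  ultimately show ?thesis ..
qed

end
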